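(* Let $\mathcal{X}$ be a set, $n\ge 1$, $f:\mathcal{X}^n\to\mathbb{R}$, and let $s,t\in(0,1)$, with $S_f^t(x)<\infty$ for all $x\in\mathcal{X}^n$. Let $Z=\sinh(Y)$ where $Y$ is a standard Gaussian. Then the randomized algorithm $M:\mathcal{X}^n\to\mathbb{R}$ given by $$M(x)=f(x)+\frac1s\cdot S_f^t(x)\cdot Z$$ is $\frac12\varepsilon^2$-CDP for $\varepsilon=2(\sqrt t+s)$.
   Context: For $x,y\in\mathcal{X}^n$, $d(x,y)$ is the number of entries in which they differ; $x,y$ are neighboring if $d(x,y)\le1$. The local sensitivity is $\mathsf{LS}_f(x)=\sup_{y:d(x,y)\le1}|f(y)-f(x)|$, and the $t$-smoothed sensitivity is $S_f^t(x)=\sup_{y\in\mathcal{X}^n}e^{-t\,d(x,y)}\,\mathsf{LS}_f(y)$. For $\alpha\in(1,\infty)$ the Rényi divergence is $D_\alpha(P\|Q)=\frac{1}{\alpha-1}\log\mathbb{E}_{X\leftarrow P}\left[(P(X)/Q(X))^{\alpha-1}\right]$ (ratio of densities, $+\infty$ if $P$ is not absolutely continuous with respect to $Q$); $D_\alpha$ of random variables means $D_\alpha$ of their distributions. A randomized algorithm $M$ on $\mathcal{X}^n$ is $\frac12\varepsilon^2$-CDP if $D_\alpha(M(x)\|M(y))\le\frac12\varepsilon^2\alpha$ for all neighboring $x,y\in\mathcal{X}^n$ and all $\alpha\in(1,\infty)$. *)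

theory Defs
  imports "HOL-Probability.Probability" "HOL-Library.NList"
begin

text \<open>
  Datasets in \<open>X\<^sup>n\<close> are the lists in \<^term>\<open>nlists n X\<close>.  The Hamming distance is only
  meaningful on lists of equal length.
\<close>

definition hamming_dist :: "'a list \<Rightarrow> 'a list \<Rightarrow> nat" where
  "hamming_dist x y = card {i. i < length x \<and> x ! i \<noteq> y ! i}"

definition neighboring :: "'a list \<Rightarrow> 'a list \<Rightarrow> bool" where
  "neighboring x y \<longleftrightarrow> hamming_dist x y \<le> 1"

text \<open>
  Sensitivities are suprema of nonnegative quantities and may be infinite, hence the type
  \<^typ>\<open>ennreal\<close>.
\<close>

definition local_sensitivity :: "'a set \<Rightarrow> nat \<Rightarrow> ('a list \<Rightarrow> real) \<Rightarrow> 'a list \<Rightarrow> ennreal" where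
  "local_sensitivity X n f x =
     (SUP y \<in> {y \<in> nlists n X. neighboring x y}. ennreal \<bar>f y - f x\<bar>)"

definition smooth_sensitivity ::
  "'a set \<Rightarrow> nat \<Rightarrow> ('a list \<Rightarrow> real) \<Rightarrow> real \<Rightarrow> 'a list \<Rightarrow> ennreal" where
  "smooth_sensitivity X n f t x =
     (SUP y \<in> nlists n X.
        ennreal (exp (- t * real (hamming_dist x y))) * local_sensitivity X n f y)"

text \<open>
  Both measures are assumed to live on the same sigma-algebra.  \<^term>\<open>RN_deriv Q P\<close> is the density
  of \<open>P\<close> with respect to \<open>Q\<close>, and \<^term>\<open>absolutely_continuous Q P\<close> says that every \<open>Q\<close>-null set
  is a \<open>P\<close>-null set.  For probability measures the density is finite \<open>Q\<close>-almost everywhere, so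
  passing to reals by \<^const>\<open>enn2real\<close> inside the integral loses nothing; the expectation itself is a
  nonnegative integral that may be infinite, in which case its logarithm is infinite.
\<close>

definition renyi_divergence :: "real \<Rightarrow> 'b measure \<Rightarrow> 'b measure \<Rightarrow> ereal" where
  "renyi_divergence \<alpha> P Q =
     (if absolutely_continuous Q P then
        (let E = (\<integral>\<^sup>+ x. ennreal (enn2real (RN_deriv Q P x) powr (\<alpha> - 1)) \<partial>P)
         in if E = \<infinity> then \<infinity> else ereal (1 / (\<alpha> - 1) * ln (enn2real E)))
      else \<infinity>)"

text \<open>
  A randomized algorithm on \<open>X\<^sup>n\<close> with outputs in the measurable space \<open>N\<close> is given by its output
  distributions.  With \<open>\<rho> = \<epsilon>\<^sup>2 / 2\<close> the predicate below says that \<open>M\<close> is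
  \<open>\<epsilon>\<^sup>2 / 2\<close>-concentrated differentially private.
\<close>

definition CDP ::
  "'a set \<Rightarrow> nat \<Rightarrow> 'b measure \<Rightarrow> real \<Rightarrow> ('a list \<Rightarrow> 'b measure) \<Rightarrow> bool" where
  "CDP X n N \<rho> M \<longleftrightarrow>
     (\<forall>x \<in> nlists n X. M x \<in> space (prob_algebra N)) \<and>
     (\<forall>x \<in> nlists n X. \<forall>y \<in> nlists n X. neighboring x y \<longrightarrow>
        (\<forall>\<alpha> > 1. renyi_divergence \<alpha> (M x) (M y) \<le> ereal (\<rho> * \<alpha>)))"

end

theory Submission
  imports Defs "HOL-Real_Asymp.Real_Asymp"
begin

text \<open>
  Let \<open>Y\<close> be a standard Gaussian and let \<open>\<kappa>\<close> be minus the log-density of \<open>sinh Y\<close>, up to a constant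
  (\<open>sinh_normal_potential\<close>).  For neighbouring \<open>x\<close> and \<open>y\<close> the outputs are \<open>f x + c sinh Y\<close> and
  \<open>f y + c' sinh Y\<close>, where the definition of smooth sensitivity makes the centres differ by at most
  \<open>s c\<close> and the scales by a factor of at most \<open>exp t\<close>.  In the coordinate
  \<open>u = arsinh ((z - f x) / c)\<close> the first output is the Gaussian itself, and the logarithm of the ratio
  of the two densities, the privacy loss, is
  \<open>\<kappa> (exp (-\<tau>) (sinh u - \<sigma>)) + \<tau> - \<kappa> (sinh u)\<close> with \<open>\<bar>\<sigma>\<bar> \<le> s\<close> and \<open>\<bar>\<tau>\<bar> \<le> t\<close>.  With
  \<open>\<beta> = \<alpha> - 1\<close>, a bound on the Renyi divergence is a bound on \<open>E exp (\<beta> loss)\<close> for Gaussian \<open>u\<close>.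

  The loss is the sum of the loss \<open>L u = \<kappa> (sinh u - \<sigma>) - \<kappa> (sinh u)\<close> of the shift and the loss of the
  subsequent change of scale.

  The loss of the shift is Lipschitz in \<open>u\<close> with constant \<open>K = 2 \<bar>\<sigma>\<bar>\<close> (\<open>lipschitz_shift_loss\<close>).  A
  \<open>K\<close>-Lipschitz function \<open>F\<close> of a Gaussian satisfies \<open>E exp F \<le> exp (E F + K\<^sup>2 / 2)\<close>
  (\<open>gaussian_mgf_lipschitz\<close>).  Applied to \<open>-L\<close> this inequality also controls the mean of \<open>L\<close>: since
  \<open>exp (-L)\<close> is a ratio of probability densities, \<open>1 = E exp (-L) \<le> exp (- E L + K\<^sup>2 / 2)\<close>, that is,
  \<open>E L \<le> K\<^sup>2 / 2\<close>.  The shift alone would thus cost \<open>\<alpha> K\<^sup>2 / 2 \<le> 2 \<alpha> s\<^sup>2\<close>.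

  The loss of the scaling needs no cancellation.  It is at most \<open>t (sqrt (1 + u\<^sup>2) + s + 1/2)\<close> pointwise
  (\<open>sinh_normal_potential_scale_le\<close>), because \<open>arsinh\<close> turns a factor \<open>exp t\<close> into a displacement of
  at most \<open>t\<close>.  This majorant is \<open>t\<close>-Lipschitz with mean at most \<open>t (2 + s)\<close>.  Bounded in this
  way, the scaling costs an amount of order \<open>t\<close> even for \<open>\<alpha>\<close> close to 1; the term \<open>sqrt t\<close> in \<open>\<epsilon>\<close>
  pays for it.

  The concentration inequality for the sum, with Lipschitz constant \<open>2 s + t\<close>, now gives
  a divergence of at most \<open>2 s\<^sup>2 + t (2 + s) + (\<alpha> - 1) (2 s + t)\<^sup>2 / 2 \<le> 2 \<alpha> (sqrt t + s)\<^sup>2\<close>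
  (\<open>cdp_budget\<close>, \<open>sinh_normal_loss_moment_le\<close>).
\<close>

section \<open>Integration on the real line\<close>

lemma antiderivative_real_line:
  fixes f :: "real \<Rightarrow> real"
  assumes cont: "continuous_on UNIV f" and int: "integrable lborel f"
  obtains G where "\<And>x. (G has_real_derivative f x) (at x)"
    and "(G \<longlongrightarrow> 0) at_bot" and "(G \<longlongrightarrow> (\<integral>x. f x \<partial>lborel)) at_top"
proof
  define G where "G y = (LINT x:{..y}|lborel. f x)" for y
  have si: "set_integrable lborel A f" if "A \<in> sets borel" for A
    using integrable_mult_indicator[OF _ int, of A] that by (simp add: set_integrable_def)
  have split: "G y = G a + (LINT x:{a..y}|lborel. f x)" if "a \<le> y" for a y
  proof -
    have "G y = (LINT x:{..a} \<union> {a<..y}|lborel. f x)"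
      unfolding G_def using that by (simp add: ivl_disj_un_one(3))
    also have "\<dots> = G a + (LINT x:{a<..y}|lborel. f x)"
      unfolding G_def by (rule set_integral_Un) (auto intro: si)
    also have "(LINT x:{a<..y}|lborel. f x) = (LINT x:{a..y}|lborel. f x)"
      unfolding set_lebesgue_integral_def
      by (rule integral_cong_AE)
        (use AE_lborel_singleton[of a] int in
          \<open>auto split: split_indicator simp: borel_measurable_integrable\<close>)
    finally show ?thesis .
  qed
  show "(G has_real_derivative f x) (at x)" for x
  proof -
    have eq: "G y = G (x - 1) + integral {x - 1..y} f" if "y \<in> {x - 1<..<x + 1}" for y
    proof -
      have "(LINT z:{x - 1..y}|lborel. f z) = integral {x - 1..y} f"
        using set_borel_integral_eq_integral(2)[OF si[of "{x - 1..y}"]] by simp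
      then show ?thesis using split[of "x - 1" y] that by simp
    qed
    have "((\<lambda>y. G (x - 1) + integral {x - 1..y} f) has_real_derivative 0 + f x)
        (at x within {x - 1..x + 1})"
      by (intro derivative_intros integral_has_real_derivative continuous_on_subset[OF cont]) auto
    then have "((\<lambda>y. G (x - 1) + integral {x - 1..y} f) has_real_derivative f x) (at x)"
      by (simp add: at_within_Icc_at)
    then show ?thesis
      by (rule has_field_derivative_transform_within_open[where S = "{x - 1<..<x + 1}"])
        (auto simp: eq)
  qed
  have "((\<lambda>y. G 0 - (LINT x:{y..0}|lborel. f x)) \<longlongrightarrow> G 0 - G 0) at_bot"
    unfolding G_def
    by (intro tendsto_diff tendsto_const tendsto_set_lebesgue_integral_at_bot si) auto
  moreover have "\<forall>\<^sub>F y in at_bot. G 0 - (LINT x:{y..0}|lborel. f x) = G y"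
    using eventually_le_at_bot[of 0] by eventually_elim (simp add: split)
  ultimately show "(G \<longlongrightarrow> 0) at_bot"
    by (simp add: tendsto_cong)
  show "(G \<longlongrightarrow> (\<integral>x. f x \<partial>lborel)) at_top"
    unfolding G_def set_lebesgue_integral_def
    by (rule tendsto_integral_at_top) (use int in auto)
qed

text \<open>
  An antiderivative with limits at both ends differs from \<open>G\<close> by a constant, so no bounded intervals
  are involved.
\<close>

lemma integral_real_line_FTC:
  fixes f G :: "real \<Rightarrow> real"
  assumes deriv: "\<And>x. (G has_real_derivative f x) (at x)"
    and cont: "continuous_on UNIV f" and int: "integrable lborel f"
    and bot: "(G \<longlongrightarrow> a) at_bot" and top: "(G \<longlongrightarrow> b) at_top"
  shows "(\<integral>x. f x \<partial>lborel) = b - a"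
proof -
  obtain H where H: "\<And>x. (H has_real_derivative f x) (at x)"
    "(H \<longlongrightarrow> 0) at_bot" "(H \<longlongrightarrow> (\<integral>x. f x \<partial>lborel)) at_top"
    using antiderivative_real_line[OF cont int] by blast
  have "((\<lambda>x. G x - H x) has_real_derivative 0) (at x)" for x
    using DERIV_diff[OF deriv H(1)] by simp
  then have "G x - H x = G 0 - H 0" for x
    using DERIV_const_ratio_const by (intro DERIV_isconst_all[rule_format]) auto
  then have eq: "G = (\<lambda>x. H x + (G 0 - H 0))" by (auto simp: algebra_simps)
  have "(G \<longlongrightarrow> 0 + (G 0 - H 0)) at_bot"
    by (subst eq) (intro tendsto_add H tendsto_const)
  then have "a = G 0 - H 0" using tendsto_unique[OF _ bot] by simp
  moreover have "(G \<longlongrightarrow> (\<integral>x. f x \<partial>lborel) + (G 0 - H 0)) at_top"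
    by (subst eq) (intro tendsto_add H tendsto_const)
  then have "b = (\<integral>x. f x \<partial>lborel) + (G 0 - H 0)" using tendsto_unique[OF _ top] by simp
  ultimately show ?thesis by simp
qed

text \<open>
  Substitution on \<open>[-n - 1, n + 1]\<close> and monotone convergence on both sides; the limits of \<open>g\<close> make the
  image intervals exhaust the line.
\<close>

lemma nn_integral_substitution_real_line:
  fixes f :: "real \<Rightarrow> ennreal" and g g' :: "real \<Rightarrow> real"
  assumes [measurable]: "f \<in> borel_measurable borel"
    and deriv: "\<And>x. (g has_real_derivative g' x) (at x)"
    and cont: "continuous_on UNIV g'" and nonneg: "\<And>x. 0 \<le> g' x"
    and top: "filterlim g at_top at_top" and bot: "filterlim g at_bot at_bot"
  shows "(\<integral>\<^sup>+x. f x \<partial>lborel) = (\<integral>\<^sup>+x. f (g x) * ennreal (g' x) \<partial>lborel)"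
proof -
  have [measurable]: "g' \<in> borel_measurable borel" "g \<in> borel_measurable borel"
    by (auto intro!: borel_measurable_continuous_onI cont continuous_at_imp_continuous_on
        DERIV_isCont[OF deriv])
  have mono: "g x \<le> g y" if "x \<le> y" for x y
    by (rule DERIV_nonneg_imp_nondecreasing[OF that]) (use deriv nonneg in blast)
  let ?b = "\<lambda>n. real n + 1"
  have b_top: "filterlim ?b at_top sequentially"
    by real_asymp
  have b_bot: "filterlim (\<lambda>n. - ?b n) at_bot sequentially"
    by real_asymp
  have restrict: "(\<integral>\<^sup>+x. f x * indicator {g (- ?b n)..g (?b n)} x \<partial>lborel) =
      (\<integral>\<^sup>+x. f (g x) * ennreal (g' x) * indicator {- ?b n..?b n} x \<partial>lborel)" for n
    by (rule nn_integral_substitution_aux)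
      (use deriv nonneg in \<open>auto intro: continuous_on_subset[OF cont]\<close>)
  have "(\<lambda>n. \<integral>\<^sup>+x. f x * indicator {g (- ?b n)..g (?b n)} x \<partial>lborel) \<longlonglongrightarrow> (\<integral>\<^sup>+x. f x \<partial>lborel)"
  proof (rule nn_integral_LIMSEQ)
    show "incseq (\<lambda>n x. f x * indicator {g (- ?b n)..g (?b n)} x)"
    proof (intro incseq_SucI le_funI mult_left_mono)
      fix n x
      have "g (- ?b (Suc n)) \<le> g (- ?b n)" "g (?b n) \<le> g (?b (Suc n))" by (auto intro: mono)
      then show "indicator {g (- ?b n)..g (?b n)} x
          \<le> (indicator {g (- ?b (Suc n))..g (?b (Suc n))} x :: ennreal)"
        by (auto split: split_indicator)
    qed simp
    fix x
    have "\<forall>\<^sub>F n in sequentially. x \<le> g (?b n)"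
      using filterlim_compose[OF top b_top] by (simp add: filterlim_at_top)
    moreover have "\<forall>\<^sub>F n in sequentially. g (- ?b n) \<le> x"
      using filterlim_compose[OF bot b_bot] by (simp add: filterlim_at_bot)
    ultimately have "\<forall>\<^sub>F n in sequentially. f x * indicator {g (- ?b n)..g (?b n)} x = f x"
      by eventually_elim simp
    then show "(\<lambda>n. f x * indicator {g (- ?b n)..g (?b n)} x) \<longlonglongrightarrow> f x"
      by (rule tendsto_eventually)
  qed simp
  moreover have "(\<lambda>n. \<integral>\<^sup>+x. f (g x) * ennreal (g' x) * indicator {- ?b n..?b n} x \<partial>lborel) \<longlonglongrightarrow>
      (\<integral>\<^sup>+x. f (g x) * ennreal (g' x) \<partial>lborel)"
  proof (rule nn_integral_LIMSEQ)
    show "incseq (\<lambda>n x. f (g x) * ennreal (g' x) * indicator {- ?b n..?b n} x)"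
      by (intro incseq_SucI le_funI mult_left_mono) (auto split: split_indicator)
    fix x :: real
    have "\<forall>\<^sub>F n in sequentially. x \<le> ?b n" using b_top by (simp add: filterlim_at_top)
    moreover have "\<forall>\<^sub>F n in sequentially. - ?b n \<le> x" using b_bot by (simp add: filterlim_at_bot)
    ultimately have "\<forall>\<^sub>F n in sequentially.
        f (g x) * ennreal (g' x) * indicator {- ?b n..?b n} x = f (g x) * ennreal (g' x)"
      by eventually_elim simp
    then show "(\<lambda>n. f (g x) * ennreal (g' x) * indicator {- ?b n..?b n} x) \<longlonglongrightarrow> f (g x) * ennreal (g' x)"
      by (rule tendsto_eventually)
  qed simp
  ultimately show ?thesis
    unfolding restrict by (rule LIMSEQ_unique)
qed

section \<open>Concentration of Lipschitz functions of a Gaussian\<close>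

lemma std_normal_density_mult_exp:
  "std_normal_density x * exp (c * x) = exp (c\<^sup>2 / 2) * normal_density c 1 x"
proof -
  have "- x\<^sup>2 / 2 + c * x = c\<^sup>2 / 2 + (- (x - c)\<^sup>2 / 2)"
    by (simp add: power2_eq_square field_simps)
  then show ?thesis
    by (simp add: normal_density_def flip: exp_add)
qed

lemma integrable_std_normal_exp_abs:
  "integrable lborel (\<lambda>x. std_normal_density x * exp (c * \<bar>x\<bar>))"
proof (rule Bochner_Integration.integrable_bound)
  show "integrable lborel (\<lambda>x. std_normal_density x * exp (c * x) + std_normal_density x * exp (- c * x))"
    unfolding std_normal_density_mult_exp by auto
  show "AE x in lborel. norm (std_normal_density x * exp (c * \<bar>x\<bar>)) \<le>
      norm (std_normal_density x * exp (c * x) + std_normal_density x * exp (- c * x))"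
  proof (rule AE_I2)
    fix x
    have "exp (c * \<bar>x\<bar>) \<le> exp (c * x) + exp (- c * x)"
      by (auto simp: abs_if)
    then have "std_normal_density x * exp (c * \<bar>x\<bar>) \<le>
        std_normal_density x * (exp (c * x) + exp (- c * x))"
      by (rule mult_left_mono) simp
    then show "norm (std_normal_density x * exp (c * \<bar>x\<bar>)) \<le>
        norm (std_normal_density x * exp (c * x) + std_normal_density x * exp (- c * x))"
      by (simp add: abs_mult flip: distrib_left)
  qed
qed auto

lemma integrable_std_normal_exp_growth:
  assumes [measurable]: "h \<in> borel_measurable borel" and bound: "\<And>x::real. \<bar>h x\<bar> \<le> C * exp (c * \<bar>x\<bar>)"
  shows "integrable lborel (\<lambda>x. std_normal_density x * h x)"
proof (rule Bochner_Integration.integrable_bound)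
  show "integrable lborel (\<lambda>x. C * (std_normal_density x * exp (c * \<bar>x\<bar>)))"
    by (intro integrable_mult_right integrable_std_normal_exp_abs)
  show "AE x in lborel. norm (std_normal_density x * h x) \<le>
      norm (C * (std_normal_density x * exp (c * \<bar>x\<bar>)))"
  proof (rule AE_I2)
    fix x
    have "\<bar>h x\<bar> \<le> \<bar>C\<bar> * exp (c * \<bar>x\<bar>)"
      by (rule order_trans[OF bound]) (auto intro: mult_right_mono)
    then have "std_normal_density x * \<bar>h x\<bar> \<le> std_normal_density x * (\<bar>C\<bar> * exp (c * \<bar>x\<bar>))"
      by (intro mult_left_mono) auto
    then show "norm (std_normal_density x * h x) \<le> norm (C * (std_normal_density x * exp (c * \<bar>x\<bar>)))"
      by (simp add: abs_mult mult_ac)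
  qed
qed auto

lemma tendsto_std_normal_exp_growth:
  assumes bound: "\<And>x::real. \<bar>h x\<bar> \<le> C * (std_normal_density x * exp (c * \<bar>x\<bar>))"
  shows "(h \<longlongrightarrow> 0) at_top" "(h \<longlongrightarrow> 0) at_bot"
proof -
  define D where "D = C / sqrt (2 * pi)"
  have b: "norm (h x) \<le> D * exp (- x\<^sup>2 / 2 + c * \<bar>x\<bar>)" for x
    using bound[of x] by (simp add: D_def std_normal_density_def mult_ac flip: exp_add)
  have lim: "((\<lambda>x::real. D * exp (- x\<^sup>2 / 2 + c * x)) \<longlongrightarrow> 0) at_top"
    by real_asymp
  show "(h \<longlongrightarrow> 0) at_top"
  proof (rule Lim_null_comparison[OF _ lim])
    show "\<forall>\<^sub>F x in at_top. norm (h x) \<le> D * exp (- x\<^sup>2 / 2 + c * x)"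
      using eventually_ge_at_top[of 0] by eventually_elim (use b in \<open>metis abs_of_nonneg\<close>)
  qed
  have "((\<lambda>x. h (- x)) \<longlongrightarrow> 0) at_top"
  proof (rule Lim_null_comparison[OF _ lim])
    show "\<forall>\<^sub>F x in at_top. norm (h (- x)) \<le> D * exp (- x\<^sup>2 / 2 + c * x)"
      using eventually_ge_at_top[of 0]
    proof eventually_elim
      case (elim x)
      then show ?case using b[of "-x"] by simp
    qed
  qed
  then show "(h \<longlongrightarrow> 0) at_bot"
    by (simp add: filterlim_at_bot_mirror)
qed

text \<open>
  If \<open>D\<close> were negative at \<open>c\<close>, the sign of its derivative would keep it below \<open>D c\<close> all the way to the
  left or all the way to the right, against the limit 0.
\<close>

lemma nonneg_if_derivative_changes_sign_once:
  fixes D p m :: "real \<Rightarrow> real"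
  assumes deriv: "\<And>x. (D has_real_derivative p x * m x) (at x)"
    and pos: "\<And>x. 0 \<le> p x" and anti: "antimono m"
    and bot: "(D \<longlongrightarrow> 0) at_bot" and top: "(D \<longlongrightarrow> 0) at_top"
  shows "0 \<le> D c"
proof (cases "0 \<le> m c")
  case True
  have le: "D x \<le> D c" if "x \<le> c" for x
  proof (rule DERIV_nonneg_imp_nondecreasing[OF that])
    fix y assume "x \<le> y" "y \<le> c"
    then have "0 \<le> p y * m y"
      using True antimonoD[OF anti, of y c] pos by (intro mult_nonneg_nonneg) auto
    then show "\<exists>d. DERIV D y :> d \<and> 0 \<le> d" using deriv by blast
  qed
  have "\<forall>\<^sub>F x in at_bot. D x \<le> D c"
    by (rule eventually_mono[OF eventually_le_at_bot[of c]]) (rule le)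
  then show ?thesis by (rule tendsto_upperbound[OF bot]) simp
next
  case False
  have le: "D x \<le> D c" if "c \<le> x" for x
  proof (rule DERIV_nonpos_imp_nonincreasing[OF that])
    fix y assume "c \<le> y" "y \<le> x"
    then have "p y * m y \<le> 0"
      using False antimonoD[OF anti, of c y] pos by (intro mult_nonneg_nonpos) auto
    then show "\<exists>d. DERIV D y :> d \<and> d \<le> 0" using deriv by blast
  qed
  have "\<forall>\<^sub>F x in at_top. D x \<le> D c"
    by (rule eventually_mono[OF eventually_ge_at_top[of c]]) (rule le)
  then show ?thesis by (rule tendsto_upperbound[OF top]) simp
qed

lemma DERIV_std_normal_density:
  "(std_normal_density has_real_derivative - x * std_normal_density x) (at x)"
proof -
  have "((\<lambda>x. c * exp (- x\<^sup>2 / 2)) has_real_derivative - x * (c * exp (- x\<^sup>2 / 2))) (at x)" for c :: real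
    by (auto intro!: derivative_eq_intros)
  then show ?thesis unfolding std_normal_density_def[abs_def] .
qed

lemma continuous_on_std_normal_density: "continuous_on A std_normal_density"
  using DERIV_std_normal_density DERIV_isCont continuous_at_imp_continuous_on by blast

lemma tendsto_std_normal_density:
  "(std_normal_density \<longlongrightarrow> 0) at_top" "(std_normal_density \<longlongrightarrow> 0) at_bot"
  by (rule tendsto_std_normal_exp_growth[of _ 1 0]; simp)+

lemma abs_mult_exp_le: "\<bar>y * exp (a * y)\<bar> \<le> exp ((\<bar>a\<bar> + 1) * \<bar>y\<bar>)" for y a :: real
proof -
  have "\<bar>y\<bar> * exp (a * y) \<le> exp \<bar>y\<bar> * exp (\<bar>a\<bar> * \<bar>y\<bar>)"
  proof (rule mult_mono)
    show "\<bar>y\<bar> \<le> exp \<bar>y\<bar>" using exp_ge_add_one_self[of "\<bar>y\<bar>"] by linarith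
  qed (auto simp flip: abs_mult)
  then show ?thesis by (simp add: abs_mult algebra_simps flip: exp_add)
qed

text \<open>
  Continuous differentiability, rather than mere Lipschitz continuity, is asked for because the
  integration by parts below uses the fundamental theorem of calculus.
\<close>

locale lipschitz_C1 =
  fixes F F' :: "real \<Rightarrow> real" and K :: real
  assumes deriv: "\<And>x. (F has_real_derivative F' x) (at x)"
    and cont': "continuous_on UNIV F'"
    and bound: "\<And>x. \<bar>F' x\<bar> \<le> K"
begin

lemma K_nonneg: "0 \<le> K"
  using bound[of 0] by linarith

lemma cont: "continuous_on A F"
  using deriv DERIV_isCont continuous_at_imp_continuous_on by blast

lemma measurable_F [measurable]: "F \<in> borel_measurable borel"
  by (intro borel_measurable_continuous_onI cont)

lemma measurable_F' [measurable]: "F' \<in> borel_measurable borel"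
  by (intro borel_measurable_continuous_onI cont')

lemma linear_growth: "\<bar>F x\<bar> \<le> \<bar>F 0\<bar> + K * \<bar>x\<bar>"
proof -
  have "norm (F x - F 0) \<le> K * norm (x - 0)"
    by (rule field_differentiable_bound[of UNIV F F']) (use deriv bound in auto)
  then show ?thesis by simp
qed

lemma exp_growth:
  "exp (c * \<bar>F x\<bar>) \<le> exp (\<bar>c\<bar> * \<bar>F 0\<bar>) * exp (\<bar>c\<bar> * K * \<bar>x\<bar>)"
proof -
  have "c * \<bar>F x\<bar> \<le> \<bar>c\<bar> * (\<bar>F 0\<bar> + K * \<bar>x\<bar>)"
    using linear_growth[of x] by (intro mult_mono) auto
  then show ?thesis by (simp add: algebra_simps flip: exp_add)
qed

lemma integrable_dominated:
  assumes [measurable]: "h \<in> borel_measurable borel" and h: "\<And>x. \<bar>h x\<bar> \<le> C * exp (c * \<bar>F x\<bar>)"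
    and C: "0 \<le> C"
  shows "integrable lborel (\<lambda>x. std_normal_density x * h x)"
proof (rule integrable_std_normal_exp_growth)
  show "\<bar>h x\<bar> \<le> (C * exp (\<bar>c\<bar> * \<bar>F 0\<bar>)) * exp (\<bar>c\<bar> * K * \<bar>x\<bar>)" for x
    using h[of x] mult_left_mono[OF exp_growth[of c x] C] by simp
qed simp

lemma integrable_exp: "integrable lborel (\<lambda>x. std_normal_density x * exp (a * F x))"
  by (rule integrable_dominated[of _ 1 "\<bar>a\<bar>"]) (auto simp flip: abs_mult)

lemma integrable_self: "integrable lborel (\<lambda>x. std_normal_density x * F x)"
proof (rule integrable_dominated[of _ 1 1])
  show "\<bar>F x\<bar> \<le> 1 * exp (1 * \<bar>F x\<bar>)" for x
    using exp_ge_add_one_self[of "\<bar>F x\<bar>"] unfolding mult_1 by linarith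
qed auto

lemma integrable_self_exp: "integrable lborel (\<lambda>x. std_normal_density x * (F x * exp (a * F x)))"
  by (rule integrable_dominated[of _ 1 "\<bar>a\<bar> + 1"]) (use abs_mult_exp_le in auto)

text \<open>
  The function \<open>J\<close> is the tail integral of \<open>F\<close> against the Gaussian density.  For \<open>F x = K x\<close>
  it is \<open>K\<close> times the density, and a centred \<open>K\<close>-Lipschitz \<open>F\<close> can do no worse: \<open>F x - K x\<close> is
  nonincreasing, so the derivative of the difference changes sign once and the difference, which
  vanishes at both ends, cannot become negative.  Applied to \<open>-F\<close> this gives the lower bound.  The
  use of \<open>J\<close> is that the covariance of \<open>F\<close> and any smooth \<open>g\<close> becomes the integral of \<open>J g'\<close>.
\<close>

lemma stein_kernel:
  assumes centered: "(\<integral>x. std_normal_density x * F x \<partial>lborel) = 0"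
  obtains J where "\<And>x. (J has_real_derivative - (std_normal_density x * F x)) (at x)"
    and "\<And>x. \<bar>J x\<bar> \<le> K * std_normal_density x"
proof -
  have "continuous_on UNIV (\<lambda>x. std_normal_density x * F x)"
    by (intro continuous_intros cont continuous_on_std_normal_density)
  from antiderivative_real_line[OF this integrable_self] centered
  obtain G where G: "\<And>x. (G has_real_derivative std_normal_density x * F x) (at x)"
    "(G \<longlongrightarrow> 0) at_bot" "(G \<longlongrightarrow> 0) at_top" by auto
  have lip: "F y - F x \<le> K * (y - x)" "F x - F y \<le> K * (y - x)" if "x \<le> y" for x y
  proof -
    have "norm (F y - F x) \<le> K * norm (y - x)"
      by (rule field_differentiable_bound[of UNIV F F']) (use deriv bound in auto)
    then show "F y - F x \<le> K * (y - x)" "F x - F y \<le> K * (y - x)" using that by auto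
  qed
  have 1: "0 \<le> K * std_normal_density c + G c" for c
  proof (rule nonneg_if_derivative_changes_sign_once[where p = std_normal_density
        and D = "\<lambda>x. K * std_normal_density x + G x" and m = "\<lambda>x. F x - K * x"])
    show "((\<lambda>x. K * std_normal_density x + G x) has_real_derivative
        std_normal_density x * (F x - K * x)) (at x)" for x
      by (auto intro!: derivative_eq_intros DERIV_std_normal_density G simp: algebra_simps)
    show "antimono (\<lambda>x. F x - K * x)"
      using lip(1) by (auto intro!: antimonoI simp: algebra_simps)
    show "((\<lambda>x. K * std_normal_density x + G x) \<longlongrightarrow> 0) at_bot"
      "((\<lambda>x. K * std_normal_density x + G x) \<longlongrightarrow> 0) at_top"
      by (auto intro!: tendsto_eq_intros tendsto_std_normal_density G)
  qed simp
  have 2: "0 \<le> K * std_normal_density c - G c" for c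
  proof (rule nonneg_if_derivative_changes_sign_once[where p = std_normal_density
        and D = "\<lambda>x. K * std_normal_density x - G x" and m = "\<lambda>x. - F x - K * x"])
    show "((\<lambda>x. K * std_normal_density x - G x) has_real_derivative
        std_normal_density x * (- F x - K * x)) (at x)" for x
      by (auto intro!: derivative_eq_intros DERIV_std_normal_density G simp: algebra_simps)
    show "antimono (\<lambda>x. - F x - K * x)"
      using lip(2) by (auto intro!: antimonoI simp: algebra_simps)
    show "((\<lambda>x. K * std_normal_density x - G x) \<longlongrightarrow> 0) at_bot"
      "((\<lambda>x. K * std_normal_density x - G x) \<longlongrightarrow> 0) at_top"
      by (auto intro!: tendsto_eq_intros tendsto_std_normal_density G)
  qed simp
  show ?thesis
  proof (rule that[of "\<lambda>x. - G x"])
    show "((\<lambda>x. - G x) has_real_derivative - (std_normal_density x * F x)) (at x)" for x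
      by (intro derivative_intros G)
    show "\<bar>- G x\<bar> \<le> K * std_normal_density x" for x
      using 1[of x] 2[of x] by linarith
  qed
qed

text \<open>
  Integration by parts against the kernel \<open>J\<close> turns the left-hand side into the integral of \<open>J\<close> times
  \<open>a F' exp (a F)\<close>; one factor \<open>K\<close> comes from \<open>F'\<close> and the other from \<open>J\<close>.
\<close>

lemma tilted_mean_le:
  assumes centered: "(\<integral>x. std_normal_density x * F x \<partial>lborel) = 0" and a: "0 \<le> a"
  shows "(\<integral>x. std_normal_density x * (F x * exp (a * F x)) \<partial>lborel) \<le>
    a * K\<^sup>2 * (\<integral>x. std_normal_density x * exp (a * F x) \<partial>lborel)"
proof -
  obtain J where J: "\<And>x. (J has_real_derivative - (std_normal_density x * F x)) (at x)"
    and J_le: "\<And>x. \<bar>J x\<bar> \<le> K * std_normal_density x"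
    using stein_kernel[OF centered] by blast
  have J_cont: "continuous_on A J" for A
    using J DERIV_isCont continuous_at_imp_continuous_on by blast
  have [measurable]: "J \<in> borel_measurable borel"
    by (intro borel_measurable_continuous_onI J_cont)
  define R where "R x = a * F' x * J x * exp (a * F x)" for x
  have [measurable]: "R \<in> borel_measurable borel"
    unfolding R_def[abs_def] by measurable
  have R_le: "\<bar>R x\<bar> \<le> a * K\<^sup>2 * (std_normal_density x * exp (a * F x))" for x
  proof -
    have "\<bar>F' x\<bar> * \<bar>J x\<bar> \<le> K * (K * std_normal_density x)"
      by (intro mult_mono bound J_le) (auto simp: K_nonneg)
    then have "a * exp (a * F x) * (\<bar>F' x\<bar> * \<bar>J x\<bar>) \<le>
        a * exp (a * F x) * (K * (K * std_normal_density x))"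
      using a by (intro mult_left_mono) auto
    then show ?thesis
      using a by (simp add: R_def abs_mult power2_eq_square mult_ac)
  qed
  have R_int: "integrable lborel R"
  proof (rule Bochner_Integration.integrable_bound)
    show "integrable lborel (\<lambda>x. a * K\<^sup>2 * (std_normal_density x * exp (a * F x)))"
      by (intro integrable_mult_right integrable_exp)
    show "AE x in lborel. norm (R x) \<le> norm (a * K\<^sup>2 * (std_normal_density x * exp (a * F x)))"
      using order_trans[OF R_le abs_ge_self] by (intro AE_I2) simp
  qed simp
  have "(\<integral>x. R x - std_normal_density x * (F x * exp (a * F x)) \<partial>lborel) = 0 - 0"
  proof (rule integral_real_line_FTC)
    show "((\<lambda>x. J x * exp (a * F x)) has_real_derivative
        R x - std_normal_density x * (F x * exp (a * F x))) (at x)" for x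
      by (auto intro!: derivative_eq_intros J deriv simp: R_def algebra_simps)
    show "continuous_on UNIV (\<lambda>x. R x - std_normal_density x * (F x * exp (a * F x)))"
      unfolding R_def by (intro continuous_intros continuous_on_std_normal_density cont cont' J_cont)
    show "integrable lborel (\<lambda>x. R x - std_normal_density x * (F x * exp (a * F x)))"
      by (intro Bochner_Integration.integrable_diff R_int integrable_self_exp)
    have "\<bar>J x * exp (a * F x)\<bar> \<le>
        K * exp (\<bar>a\<bar> * \<bar>F 0\<bar>) * (std_normal_density x * exp (\<bar>a\<bar> * K * \<bar>x\<bar>))" for x
    proof -
      have "\<bar>J x\<bar> * exp (a * F x) \<le> (K * std_normal_density x) *
          (exp (\<bar>a\<bar> * \<bar>F 0\<bar>) * exp (\<bar>a\<bar> * K * \<bar>x\<bar>))"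
      proof (rule mult_mono[OF J_le])
        have "exp (a * F x) \<le> exp (\<bar>a\<bar> * \<bar>F x\<bar>)" by (simp flip: abs_mult)
        also have "\<dots> \<le> exp (\<bar>a\<bar> * \<bar>F 0\<bar>) * exp (\<bar>a\<bar> * K * \<bar>x\<bar>)"
          using exp_growth[of "\<bar>a\<bar>" x] by simp
        finally show "exp (a * F x) \<le> exp (\<bar>a\<bar> * \<bar>F 0\<bar>) * exp (\<bar>a\<bar> * K * \<bar>x\<bar>)" .
      qed (auto simp: K_nonneg)
      then show ?thesis by (simp add: abs_mult mult_ac)
    qed
    from tendsto_std_normal_exp_growth[OF this]
    show "((\<lambda>x. J x * exp (a * F x)) \<longlongrightarrow> 0) at_bot" "((\<lambda>x. J x * exp (a * F x)) \<longlongrightarrow> 0) at_top"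
      by auto
  qed
  then have "(\<integral>x. std_normal_density x * (F x * exp (a * F x)) \<partial>lborel) = (\<integral>x. R x \<partial>lborel)"
    using R_int integrable_self_exp[of a] by simp
  also have "\<dots> \<le> (\<integral>x. a * K\<^sup>2 * (std_normal_density x * exp (a * F x)) \<partial>lborel)"
    using R_le by (intro integral_mono R_int integrable_mult_right integrable_exp) (simp add: abs_le_iff)
  finally show ?thesis by simp
qed

text \<open>
  Differentiation under the integral sign.  For \<open>\<bar>h\<bar> < 1\<close> the difference quotients of
  \<open>exp (a y)\<close> are dominated by \<open>exp ((\<bar>a\<bar> + 2) \<bar>y\<bar>)\<close>.
\<close>

lemma DERIV_mgf:
  "((\<lambda>a. \<integral>x. std_normal_density x * exp (a * F x) \<partial>lborel) has_real_derivative
    (\<integral>x. std_normal_density x * (F x * exp (a * F x)) \<partial>lborel)) (at a)"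
  unfolding DERIV_def
proof -
  let ?N = "\<lambda>a. \<integral>x. std_normal_density x * exp (a * F x) \<partial>lborel"
  have bnd: "\<bar>(exp (h * y) - 1) / h\<bar> \<le> \<bar>y\<bar> * exp \<bar>y\<bar>" if "\<bar>h\<bar> < 1" "h \<noteq> 0" for h y :: real
  proof -
    have "\<bar>exp z - 1\<bar> \<le> \<bar>z\<bar> * exp \<bar>z\<bar>" for z :: real
    proof (cases "0 \<le> z")
      case True
      have "1 - exp (- z) \<le> z" using exp_ge_add_one_self[of "-z"] by simp
      then have "exp z * (1 - exp (- z)) \<le> exp z * z" by (intro mult_left_mono) auto
      then show ?thesis using True by (simp add: algebra_simps flip: exp_add)
    next
      case False
      have "1 - exp z \<le> - z" using exp_ge_add_one_self[of z] by linarith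
      also have "\<dots> \<le> - z * exp (- z)" using False mult_left_mono[of 1 "exp (- z)" "-z"] by simp
      finally show ?thesis using False by simp
    qed
    from this[of "h * y"] have "\<bar>exp (h * y) - 1\<bar> \<le> \<bar>h\<bar> * (\<bar>y\<bar> * exp \<bar>h * y\<bar>)"
      by (simp add: abs_mult)
    also have "\<dots> \<le> \<bar>h\<bar> * (\<bar>y\<bar> * exp \<bar>y\<bar>)"
      using that mult_right_mono[of "\<bar>h\<bar>" 1 "\<bar>y\<bar>"] by (intro mult_left_mono) (auto simp: abs_mult)
    finally show ?thesis using that by (simp add: abs_mult field_simps)
  qed
  have "((\<lambda>h. (?N (a + h) - ?N a) / h) \<longlongrightarrow>
      (\<integral>x. std_normal_density x * (F x * exp (a * F x)) \<partial>lborel)) (at 0 within {-1<..<1})"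
    unfolding tendsto_at_iff_sequentially
  proof (intro allI impI)
    fix X :: "nat \<Rightarrow> real" assume X: "\<forall>i. X i \<in> {- 1<..<1} - {0}" "X \<longlonglongrightarrow> 0"
    let ?q = "\<lambda>i x. (exp (X i * F x) - 1) / X i"
    have "(\<lambda>i. \<integral>x. std_normal_density x * (exp (a * F x) * ?q i x) \<partial>lborel) \<longlonglongrightarrow>
        (\<integral>x. std_normal_density x * (F x * exp (a * F x)) \<partial>lborel)"
    proof (rule integral_dominated_convergence)
      show "integrable lborel (\<lambda>x. std_normal_density x * exp ((\<bar>a\<bar> + 2) * \<bar>F x\<bar>))"
        by (rule integrable_dominated[of _ 1 "\<bar>a\<bar> + 2"]) auto
      show "AE x in lborel. norm (std_normal_density x * (exp (a * F x) * ?q i x)) \<le>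
          std_normal_density x * exp ((\<bar>a\<bar> + 2) * \<bar>F x\<bar>)" for i
      proof (rule AE_I2)
        fix x
        have "exp (a * F x) * \<bar>?q i x\<bar> \<le> exp (\<bar>a\<bar> * \<bar>F x\<bar>) * exp (2 * \<bar>F x\<bar>)"
        proof (rule mult_mono)
          show "exp (a * F x) \<le> exp (\<bar>a\<bar> * \<bar>F x\<bar>)" by (simp flip: abs_mult)
          have "\<bar>?q i x\<bar> \<le> \<bar>F x\<bar> * exp \<bar>F x\<bar>" using X(1) by (intro bnd) (auto simp: abs_less_iff)
          also have "\<dots> \<le> exp (2 * \<bar>F x\<bar>)" using abs_mult_exp_le[of "\<bar>F x\<bar>" 1] by simp
          finally show "\<bar>?q i x\<bar> \<le> exp (2 * \<bar>F x\<bar>)" .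
        qed auto
        then have "exp (a * F x) * \<bar>?q i x\<bar> \<le> exp ((\<bar>a\<bar> + 2) * \<bar>F x\<bar>)"
          by (simp add: algebra_simps flip: exp_add)
        from mult_left_mono[OF this, of "std_normal_density x"]
        show "norm (std_normal_density x * (exp (a * F x) * ?q i x)) \<le>
            std_normal_density x * exp ((\<bar>a\<bar> + 2) * \<bar>F x\<bar>)"
          by (simp add: abs_mult)
      qed
      show "AE x in lborel. (\<lambda>i. std_normal_density x * (exp (a * F x) * ?q i x)) \<longlonglongrightarrow>
          std_normal_density x * (F x * exp (a * F x))"
      proof (rule AE_I2)
        fix x
        have "((\<lambda>h. exp (h * F x)) has_real_derivative F x) (at 0)"
          by (auto intro!: derivative_eq_intros)
        then have "((\<lambda>h. (exp (h * F x) - 1) / h) \<longlongrightarrow> F x) (at 0)"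
          by (simp add: DERIV_def)
        then have "(\<lambda>i. ?q i x) \<longlonglongrightarrow> F x"
          using X unfolding tendsto_at_iff_sequentially by (auto simp: o_def)
        then show "(\<lambda>i. std_normal_density x * (exp (a * F x) * ?q i x)) \<longlonglongrightarrow>
          std_normal_density x * (F x * exp (a * F x))"
          by (subst mult.commute[of "F x"]) (intro tendsto_mult tendsto_const)
      qed
    qed auto
    moreover have "(\<integral>x. std_normal_density x * (exp (a * F x) * ?q i x) \<partial>lborel) =
        (?N (a + X i) - ?N a) / X i" for i
    proof -
      have "?N (a + X i) - ?N a =
          (\<integral>x. std_normal_density x * exp ((a + X i) * F x) - std_normal_density x * exp (a * F x) \<partial>lborel)"
        by (rule Bochner_Integration.integral_diff[symmetric]) (rule integrable_exp)+
      then have "(?N (a + X i) - ?N a) / X i =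
          (\<integral>x. (std_normal_density x * exp ((a + X i) * F x) - std_normal_density x * exp (a * F x)) / X i \<partial>lborel)"
        by simp
      also have "\<dots> = (\<integral>x. std_normal_density x * (exp (a * F x) * ?q i x) \<partial>lborel)"
      proof (intro Bochner_Integration.integral_cong refl)
        fix x
        have "exp ((a + X i) * F x) = exp (a * F x) * exp (X i * F x)"
          by (simp add: distrib_right exp_add)
        then show "(std_normal_density x * exp ((a + X i) * F x) - std_normal_density x * exp (a * F x)) / X i =
            std_normal_density x * (exp (a * F x) * ?q i x)"
          by (simp add: algebra_simps)
      qed
      finally show ?thesis by (rule sym)
    qed
    ultimately show "((\<lambda>h. (?N (a + h) - ?N a) / h) \<circ> X) \<longlonglongrightarrow>
        (\<integral>x. std_normal_density x * (F x * exp (a * F x)) \<partial>lborel)"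
      by (simp only: o_def)
  qed
  then show "((\<lambda>h. (?N (a + h) - ?N a) / h) \<longlongrightarrow>
      (\<integral>x. std_normal_density x * (F x * exp (a * F x)) \<partial>lborel)) (at 0)"
    by (simp add: at_within_open[of 0 "{-1<..<1}"])
qed

text \<open>
  The preceding two lemmas say that \<open>N a = E exp (a F)\<close> satisfies \<open>N' \<le> a K\<^sup>2 N\<close> for
  \<open>a \<ge> 0\<close>; hence
  \<open>N a exp (- a\<^sup>2 K\<^sup>2 / 2)\<close> decreases from its value 1 at \<open>a = 0\<close>.
\<close>

lemma centered_mgf_le:
  assumes centered: "(\<integral>x. std_normal_density x * F x \<partial>lborel) = 0"
  shows "(\<integral>x. std_normal_density x * exp (F x) \<partial>lborel) \<le> exp (K\<^sup>2 / 2)"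
proof -
  define N where "N a = (\<integral>x. std_normal_density x * exp (a * F x) \<partial>lborel)" for a
  define N' where "N' a = (\<integral>x. std_normal_density x * (F x * exp (a * F x)) \<partial>lborel)" for a
  have "N 1 * exp (- (1\<^sup>2 * K\<^sup>2 / 2)) \<le> N 0 * exp (- (0\<^sup>2 * K\<^sup>2 / 2))"
  proof (rule DERIV_nonpos_imp_nonincreasing[of 0 1 "\<lambda>a. N a * exp (- (a\<^sup>2 * K\<^sup>2 / 2))"])
    fix a :: real assume "0 \<le> a" "a \<le> 1"
    have "((\<lambda>a. N a * exp (- (a\<^sup>2 * K\<^sup>2 / 2))) has_real_derivative
        (N' a - a * K\<^sup>2 * N a) * exp (- (a\<^sup>2 * K\<^sup>2 / 2))) (at a)"
      unfolding N_def N'_def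
      by (auto intro!: derivative_eq_intros DERIV_mgf simp: algebra_simps)
    moreover have "N' a \<le> a * K\<^sup>2 * N a"
      unfolding N_def N'_def by (rule tilted_mean_le[OF centered \<open>0 \<le> a\<close>])
    then have "(N' a - a * K\<^sup>2 * N a) * exp (- (a\<^sup>2 * K\<^sup>2 / 2)) \<le> 0"
      by (intro mult_nonpos_nonneg) auto
    ultimately show "\<exists>d. DERIV (\<lambda>a. N a * exp (- (a\<^sup>2 * K\<^sup>2 / 2))) a :> d \<and> d \<le> 0"
      by blast
  qed simp
  then show ?thesis by (simp add: N_def exp_minus field_simps)
qed

end

text \<open>
  Equality holds for linear \<open>F\<close>.  The constant \<open>1 / 2\<close> enters the privacy bound directly: it makes the
  shift alone cost exactly the \<open>2 \<alpha> s\<^sup>2\<close> that \<open>\<epsilon> = 2 s\<close> provides.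
\<close>

lemma gaussian_mgf_lipschitz:
  assumes "lipschitz_C1 F F' K"
  shows "(\<integral>x. std_normal_density x * exp (F x) \<partial>lborel) \<le>
    exp ((\<integral>x. std_normal_density x * F x \<partial>lborel) + K\<^sup>2 / 2)"
proof -
  interpret F: lipschitz_C1 F F' K by fact
  define m where "m = (\<integral>x. std_normal_density x * F x \<partial>lborel)"
  interpret F0: lipschitz_C1 "\<lambda>x. F x - m" F' K
    by unfold_locales (auto intro!: derivative_eq_intros F.deriv F.cont' F.bound)
  have "(\<integral>x. std_normal_density x * (F x - m) \<partial>lborel) =
      (\<integral>x. std_normal_density x * F x - m * std_normal_density x \<partial>lborel)"
    by (simp add: algebra_simps)
  also have "\<dots> = 0"
    using F.integrable_self by (simp add: m_def)
  finally have "(\<integral>x. std_normal_density x * exp (F x - m) \<partial>lborel) \<le> exp (K\<^sup>2 / 2)"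
    by (rule F0.centered_mgf_le)
  moreover have "(\<integral>x. std_normal_density x * exp (F x) \<partial>lborel) =
      (\<integral>x. exp m * (std_normal_density x * exp (F x - m)) \<partial>lborel)"
    by (simp add: exp_diff)
  ultimately show ?thesis
    by (simp add: exp_add flip: m_def)
qed

lemma lipschitz_C1_add:
  assumes "lipschitz_C1 F F' K" "lipschitz_C1 G G' L"
  shows "lipschitz_C1 (\<lambda>x. F x + G x) (\<lambda>x. F' x + G' x) (K + L)"
proof -
  interpret F: lipschitz_C1 F F' K by fact
  interpret G: lipschitz_C1 G G' L by fact
  show ?thesis
  proof
    show "((\<lambda>x. F x + G x) has_real_derivative F' x + G' x) (at x)" for x
      by (intro DERIV_add F.deriv G.deriv)
    show "continuous_on UNIV (\<lambda>x. F' x + G' x)"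
      by (intro continuous_intros F.cont' G.cont')
    show "\<bar>F' x + G' x\<bar> \<le> K + L" for x
      using F.bound[of x] G.bound[of x] by linarith
  qed
qed

lemma lipschitz_C1_cmult:
  assumes "lipschitz_C1 F F' K"
  shows "lipschitz_C1 (\<lambda>x. a * F x) (\<lambda>x. a * F' x) (\<bar>a\<bar> * K)"
proof -
  interpret F: lipschitz_C1 F F' K by fact
  show ?thesis
  proof
    show "((\<lambda>x. a * F x) has_real_derivative a * F' x) (at x)" for x
      by (intro DERIV_cmult F.deriv)
    show "continuous_on UNIV (\<lambda>x. a * F' x)"
      by (intro continuous_intros F.cont')
    show "\<bar>a * F' x\<bar> \<le> \<bar>a\<bar> * K" for x
      unfolding abs_mult by (intro mult_left_mono F.bound) auto
  qed
qed

section \<open>The log-density of the hyperbolic sine of a Gaussian\<close>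

text \<open>
  Minus the log-density of \<open>sinh Y\<close> for a standard Gaussian \<open>Y\<close>, without the constant
  \<open>ln (2 * pi) / 2\<close>.
\<close>

definition sinh_normal_potential :: "real \<Rightarrow> real" where
  "sinh_normal_potential z = (arsinh z)\<^sup>2 / 2 + ln (1 + z\<^sup>2) / 2"

definition sinh_normal_score :: "real \<Rightarrow> real" where
  "sinh_normal_score z = arsinh z / sqrt (1 + z\<^sup>2) + z / (1 + z\<^sup>2)"

lemma one_plus_square_pos [simp]: "0 < 1 + z\<^sup>2" for z :: real
  by (rule add_pos_nonneg) auto

lemma one_plus_square_nonneg [simp]: "0 \<le> 1 + z\<^sup>2" for z :: real
  by simp

lemma one_plus_square_neq_0 [simp]: "1 + z\<^sup>2 \<noteq> 0" for z :: real
  using one_plus_square_pos[of z] by linarith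

lemma sinh_normal_potential_minus [simp]: "sinh_normal_potential (- z) = sinh_normal_potential z"
  by (simp add: sinh_normal_potential_def)

lemma sinh_normal_score_minus [simp]: "sinh_normal_score (- z) = - sinh_normal_score z"
  by (simp add: sinh_normal_score_def)

lemma DERIV_sinh_normal_potential [THEN DERIV_chain2, derivative_intros]:
  "(sinh_normal_potential has_real_derivative sinh_normal_score z) (at z)"
proof -
  have "((\<lambda>z. (arsinh z)\<^sup>2) has_real_derivative 2 * arsinh z * (1 / sqrt (1 + z\<^sup>2))) (at z)"
    by (auto intro!: derivative_eq_intros simp: add_ac)
  moreover have "((\<lambda>z. ln (1 + z\<^sup>2)) has_real_derivative 2 * z / (1 + z\<^sup>2)) (at z)"
    by (auto intro!: derivative_eq_intros)
  ultimately have "(sinh_normal_potential has_real_derivative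
      2 * arsinh z * (1 / sqrt (1 + z\<^sup>2)) / 2 + 2 * z / (1 + z\<^sup>2) / 2) (at z)"
    unfolding sinh_normal_potential_def[abs_def] by (intro DERIV_add DERIV_cdivide)
  moreover have "2 * z / b / 2 = z / b" for b :: real by simp
  moreover have "2 * arsinh z * (1 / b) / 2 = arsinh z / b" for b by simp
  ultimately show ?thesis by (simp only: sinh_normal_score_def)
qed

lemma continuous_sinh_normal_score: "continuous_on A sinh_normal_score"
  unfolding sinh_normal_score_def[abs_def]
  by (intro continuous_intros) auto

lemma sqrt_one_plus_square_ge: "1 \<le> sqrt (1 + z\<^sup>2)" "\<bar>z\<bar> \<le> sqrt (1 + z\<^sup>2)"
  by (auto intro!: real_le_rsqrt)

lemma abs_arsinh_diff_le: "\<bar>arsinh x - arsinh y\<bar> \<le> \<bar>x - y\<bar>" for x y :: real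
proof -
  have "norm (arsinh x - arsinh y) \<le> 1 * norm (x - y)"
  proof (rule field_differentiable_bound[of UNIV])
    show "(arsinh has_field_derivative 1 / sqrt (z\<^sup>2 + 1)) (at z within UNIV)" for z :: real
      by (rule arsinh_real_has_field_derivative)
    show "norm (1 / sqrt (z\<^sup>2 + 1)) \<le> 1" for z
      using sqrt_one_plus_square_ge(1)[of z] by (simp add: add_ac)
  qed auto
  then show ?thesis by simp
qed

lemma arsinh_real_le_iff [simp]: "arsinh x \<le> arsinh y \<longleftrightarrow> x \<le> y" for x y :: real
  by (simp flip: not_less)

lemma arsinh_bounds: "0 \<le> arsinh z" "arsinh z \<le> z" if "0 \<le> z" for z :: real
  using that abs_arsinh_diff_le[of z 0] by (auto simp flip: not_less)

lemma DERIV_sqrt_one_plus_square: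
  "((\<lambda>z. sqrt (1 + z\<^sup>2)) has_real_derivative z / sqrt (1 + z\<^sup>2)) (at z)"
proof -
  have "((\<lambda>z. 1 + z\<^sup>2) has_real_derivative 2 * z) (at z)"
    by (auto intro!: derivative_eq_intros)
  from DERIV_chain2[OF DERIV_real_sqrt[OF one_plus_square_pos] this]
  have "((\<lambda>z. sqrt (1 + z\<^sup>2)) has_real_derivative inverse (sqrt (1 + z\<^sup>2)) / 2 * (2 * z)) (at z)" .
  moreover have "inverse (sqrt (1 + z\<^sup>2)) / 2 * (2 * z) = z / sqrt (1 + z\<^sup>2)"
    by simp (rule divide_inverse_commute[symmetric])
  ultimately show ?thesis by simp
qed

lemma abs_divide_sqrt_one_plus_square_le: "\<bar>z / sqrt (1 + z\<^sup>2)\<bar> \<le> 1"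
  using sqrt_one_plus_square_ge[of z] by (simp add: divide_simps)

lemma abs_sqrt_one_plus_square_diff_le: "\<bar>sqrt (1 + z\<^sup>2) - sqrt (1 + w\<^sup>2)\<bar> \<le> \<bar>z - w\<bar>"
proof -
  have "norm (sqrt (1 + z\<^sup>2) - sqrt (1 + w\<^sup>2)) \<le> 1 * norm (z - w)"
  proof (rule field_differentiable_bound[of UNIV])
    show "((\<lambda>z. sqrt (1 + z\<^sup>2)) has_field_derivative z / sqrt (1 + z\<^sup>2)) (at z within UNIV)" for z :: real
      by (rule DERIV_sqrt_one_plus_square)
    show "norm (z / sqrt (1 + z\<^sup>2)) \<le> 1" for z
      using abs_divide_sqrt_one_plus_square_le by simp
  qed auto
  then show ?thesis by simp
qed

text \<open>
  The difference has numerator \<open>(z - w) (1 - z w)\<close>, and \<open>\<bar>1 - z w\<bar>\<close> is at most the product of the two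
  square roots by the identity \<open>(1 - z w)\<^sup>2 + (z + w)\<^sup>2 = (1 + z\<^sup>2) (1 + w\<^sup>2)\<close>.
\<close>

lemma rational_score_diff_le:
  "sqrt (1 + z\<^sup>2) * \<bar>z / (1 + z\<^sup>2) - w / (1 + w\<^sup>2)\<bar> \<le> \<bar>z - w\<bar>" for z w :: real
proof -
  define c d where "c = sqrt (1 + z\<^sup>2)" and "d = sqrt (1 + w\<^sup>2)"
  have c: "1 \<le> c" "c\<^sup>2 = 1 + z\<^sup>2" and d: "1 \<le> d" "d\<^sup>2 = 1 + w\<^sup>2"
    by (simp_all add: c_def d_def)
  have "(1 - z * w)\<^sup>2 \<le> (1 - z * w)\<^sup>2 + (z + w)\<^sup>2" by simp
  also have "\<dots> = (c * d)\<^sup>2"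
    unfolding power_mult_distrib c d by (simp add: power2_eq_square algebra_simps)
  finally have le: "\<bar>1 - z * w\<bar> \<le> c * d"
    using c(1) d(1) by (simp flip: abs_le_square_iff)
  have "z / c\<^sup>2 - w / d\<^sup>2 = (z * d\<^sup>2 - w * c\<^sup>2) / (c\<^sup>2 * d\<^sup>2)"
    using c d by (simp add: diff_frac_eq)
  also have "z * d\<^sup>2 - w * c\<^sup>2 = (z - w) * (1 - z * w)"
    unfolding c d by (simp add: power2_eq_square algebra_simps)
  finally have "c * \<bar>z / c\<^sup>2 - w / d\<^sup>2\<bar> = \<bar>z - w\<bar> * (\<bar>1 - z * w\<bar> / (c * d)) / d"
    using c(1) d(1) by (simp add: abs_mult power2_eq_square divide_simps)
  also have "\<dots> \<le> \<bar>z - w\<bar> * 1 / 1"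
    using le c d by (intro frac_le mult_left_mono mult_nonneg_nonneg) auto
  finally show ?thesis by (simp add: c_def d_def)
qed

text \<open>
  After multiplication by \<open>c = sqrt (1 + z\<^sup>2)\<close> the difference becomes \<open>arsinh z - (c / d) arsinh w\<close>.
  For nonnegative arguments, the deviation of \<open>c / d\<close> from 1 and the difference of the two values of
  \<open>arsinh\<close> pull in opposite directions, so that one Lipschitz estimate suffices for each side.
\<close>

lemma arsinh_score_diff_le_nonneg:
  fixes z w :: real
  assumes z: "0 \<le> z" and w: "0 \<le> w"
  shows "sqrt (1 + z\<^sup>2) * \<bar>arsinh z / sqrt (1 + z\<^sup>2) - arsinh w / sqrt (1 + w\<^sup>2)\<bar> \<le> \<bar>z - w\<bar>"
proof -
  define c d where "c = sqrt (1 + z\<^sup>2)" and "d = sqrt (1 + w\<^sup>2)"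
  have c: "1 \<le> c" "z \<le> c" and d: "1 \<le> d" "w \<le> d"
    using sqrt_one_plus_square_ge[of z] sqrt_one_plus_square_ge[of w] by (auto simp: c_def d_def)
  have cd: "\<bar>c - d\<bar> \<le> \<bar>z - w\<bar>"
    unfolding c_def d_def by (rule abs_sqrt_one_plus_square_diff_le)
  have ar: "\<bar>arsinh z - arsinh w\<bar> \<le> \<bar>z - w\<bar>" by (rule abs_arsinh_diff_le)
  note arz = arsinh_bounds[OF z] and arw = arsinh_bounds[OF w]
  have eq: "c * \<bar>arsinh z / c - arsinh w / d\<bar> = \<bar>arsinh z - arsinh w * (c / d)\<bar>"
    using c by (simp add: abs_mult_pos' right_diff_distrib mult.commute)
  (* Both square roots are 1-Lipschitz, and y / d is at most 1. *)
  have small: "\<bar>y * (c / d) - y\<bar> \<le> \<bar>z - w\<bar>" if "0 \<le> y" "y \<le> d" for y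
  proof -
    have "y * (c / d) - y = (y / d) * (c - d)" using d by (simp add: field_simps)
    moreover have "\<bar>(y / d) * (c - d)\<bar> \<le> 1 * \<bar>z - w\<bar>"
      unfolding abs_mult using that d cd by (intro mult_mono) auto
    ultimately show ?thesis by simp
  qed
  have "\<bar>arsinh z - arsinh w * (c / d)\<bar> \<le> \<bar>z - w\<bar>"
  proof (cases "w \<le> z")
    case True
    then have "d \<le> c" using w by (auto simp: c_def d_def intro!: power_mono)
    then have "arsinh w * 1 \<le> arsinh w * (c / d)"
      using arw d by (intro mult_left_mono) auto
    moreover have "arsinh w \<le> arsinh z" using True by simp
    ultimately show ?thesis
      using small[of "arsinh w"] arw d ar by linarith
  next
    case False
    then have "c \<le> d" using z by (auto simp: c_def d_def intro!: power_mono)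
    then have *: "arsinh w * (c / d) \<le> arsinh w * 1"
      using arw d by (intro mult_left_mono) auto
    have "arsinh z \<le> arsinh w" using False by simp
    then have "arsinh z * (c / d) \<le> arsinh w * (c / d)"
      using c d by (intro mult_right_mono) auto
    then show ?thesis
      using small[of "arsinh z"] * arz arw c d \<open>c \<le> d\<close> ar by linarith
  qed
  then show ?thesis by (simp add: eq flip: c_def d_def)
qed

text \<open>
  The case of arguments of opposite sign in the next lemma.  It is delicate: to third order, the
  estimate of the \<open>arsinh\<close> part of the score alone is an equality for \<open>z = 2 w\<close>, so the two
  parts of the score have to be estimated together.  After \<open>arsinh z \<le> z\<close> and \<open>arsinh w \<le> w\<close> the
  claim is algebraic.
\<close>

lemma score_sum_le:
  assumes z: "0 \<le> z" and w: "0 \<le> w" and zw: "z + w \<le> 1"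
  shows "sqrt (1 + z\<^sup>2) * (sinh_normal_score z + sinh_normal_score w) \<le> 2 * (z + w)"
proof -
  define c d where "c = sqrt (1 + z\<^sup>2)" and "d = sqrt (1 + w\<^sup>2)"
  have c: "1 \<le> c" "c\<^sup>2 = 1 + z\<^sup>2" and d: "1 \<le> d" "d\<^sup>2 = 1 + w\<^sup>2"
    by (simp_all add: c_def d_def)
  have "c * (sinh_normal_score z + sinh_normal_score w) =
      c * (arsinh z / c + z / c\<^sup>2) + c * (arsinh w / d + w / d\<^sup>2)"
    unfolding sinh_normal_score_def c_def d_def by (simp add: algebra_simps)
  also have "c * (arsinh z / c + z / c\<^sup>2) = arsinh z + z / c"
    using c(1) by (simp add: field_simps power2_eq_square)
  also have "arsinh z + z / c \<le> z + z / c"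
    using arsinh_bounds(2)[OF z] by simp
  also have "c * (arsinh w / d + w / d\<^sup>2) \<le> c * (w / d + w / d\<^sup>2)"
    using arsinh_bounds(2)[OF w] c d by (intro mult_left_mono add_right_mono divide_right_mono) auto
  finally have 1: "c * (sinh_normal_score z + sinh_normal_score w) \<le> z + z / c + c * (w / d + w / d\<^sup>2)"
    by simp
  have "z + z / c + c * (w / d + w / d\<^sup>2) \<le> 2 * (z + w)"
  proof (cases "z \<le> w")
    case True
    then have "c \<le> d" using z by (auto simp: c_def d_def intro!: power_mono)
    moreover have "d * 1 \<le> d * d" using d by (intro mult_left_mono) auto
    ultimately have "w * (c / d) \<le> w * 1" "w * (c / d\<^sup>2) \<le> w * 1"
      using w c d by (intro mult_left_mono; simp add: power2_eq_square)+
    moreover have "z / c \<le> z / 1" using z c by (intro divide_left_mono) auto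
    ultimately show ?thesis by (simp add: algebra_simps)
  next
    case False
    have "z * z \<le> 1 * 1" using z w zw by (intro mult_mono) auto
    then have c2: "c \<le> 2" unfolding c_def by (intro real_le_lsqrt) (auto simp: power2_eq_square)
    (* Here w is at most 1/2, and 4/5 is the slope of the chord of 1 - 1 / (1 + x) over [0, 1/4],
       where x is the square of w.  So w / (1 + w^2) falls short of w by at least 4/5 w^3. *)
    have "w * w \<le> (1 / 2) * (1 / 2)" using False w zw by (intro mult_mono) auto
    then have "w\<^sup>2 * w\<^sup>2 \<le> (1 / 4) * w\<^sup>2" by (intro mult_right_mono) (auto simp: power2_eq_square)
    then have "1 \<le> (1 - 4 / 5 * w\<^sup>2) * d\<^sup>2" unfolding d by (simp add: algebra_simps)
    then have "1 / d\<^sup>2 \<le> 1 - 4 / 5 * w\<^sup>2" using d by (simp add: divide_simps)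
    moreover have "1 / d \<le> 1" using d by simp
    ultimately have "c * w * (1 / d + 1 / d\<^sup>2) \<le> c * w * (2 - 4 / 5 * w\<^sup>2)"
      using c w by (intro mult_left_mono) auto
    moreover have "c * (w / d + w / d\<^sup>2) = c * w * (1 / d + 1 / d\<^sup>2)"
      by (simp add: algebra_simps)
    ultimately have "z + z / c + c * (w / d + w / d\<^sup>2) \<le> z + (z / c + c * w * (2 - 4 / 5 * w\<^sup>2))"
      by (simp only: add.assoc add_le_cancel_left)
    also have "z / c + c * w * (2 - 4 / 5 * w\<^sup>2) \<le> z + 2 * w"
    proof -
      (* In terms of y = z / c, the excess (c - 1) (2 w - y) of the other terms is a multiple of
         y^2 (2 w - y), whose maximum 32/27 w^3 over y is attained at y = 4/3 w. *)
      define y where "y = z / c"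
      have y: "z = c * y" "0 \<le> y" using c z by (auto simp: y_def)
      have cub: "y\<^sup>2 * (2 * w - y) \<le> 32 / 27 * w ^ 3"
      proof -
        define v where "v = w / 3"
        have v: "w = 3 * v" "0 \<le> v" using w by (auto simp: v_def)
        have "0 \<le> (y - 4 * v)\<^sup>2 * (y + 2 * v)" using y v by auto
        also have "\<dots> = 32 * v ^ 3 - y\<^sup>2 * (6 * v - y)"
          by (simp add: power2_eq_square power3_eq_cube algebra_simps)
        finally show ?thesis by (simp add: v(1) power_mult_distrib)
      qed
      have "(c - 1) * (c + 1) = c\<^sup>2 - 1"
        by (simp add: power2_eq_square algebra_simps)
      also have "\<dots> = z\<^sup>2" using c(2) by simp
      also have "\<dots> = c\<^sup>2 * y\<^sup>2" by (simp only: y(1) power_mult_distrib)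
      finally have square: "(c - 1) * (c + 1) = c\<^sup>2 * y\<^sup>2" .
      have "(c + 1) * ((c - 1) * (2 * w - y)) = (c - 1) * (c + 1) * (2 * w - y)"
        by (simp only: mult_ac)
      also have "\<dots> = c\<^sup>2 * (y\<^sup>2 * (2 * w - y))"
        by (simp only: square mult.assoc)
      also have "\<dots> \<le> c\<^sup>2 * (32 / 27 * w ^ 3)"
        by (intro mult_left_mono cub) auto
      also have "\<dots> \<le> (c + 1) * (4 / 5 * c * w ^ 3)"
      proof -
        have "32 / 27 * c \<le> 4 / 5 * (c + 1)" using c2 by simp
        then have "(32 / 27 * c) * (c * w ^ 3) \<le> (4 / 5 * (c + 1)) * (c * w ^ 3)"
          using c w by (intro mult_right_mono) auto
        then show ?thesis by (simp add: power2_eq_square algebra_simps)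
      qed
      finally have "(c - 1) * (2 * w - y) \<le> 4 / 5 * c * w ^ 3"
        by (rule mult_left_le_imp_le) (use c(1) in simp)
      then have "y + c * w * (2 - 4 / 5 * w\<^sup>2) \<le> c * y + 2 * w"
        by (simp add: power2_eq_square power3_eq_cube algebra_simps)
      then show ?thesis by (simp only: y(1)[symmetric] y_def[symmetric])
    qed
    finally show ?thesis by simp
  qed
  with 1 show ?thesis by (simp add: c_def)
qed

text \<open>
  With \<open>z = sinh u\<close> the square root is \<open>cosh u\<close>, the factor by which the coordinate \<open>u\<close> stretches
  derivatives.  So this is the Lipschitz estimate for the privacy loss of a shift by \<open>z - w\<close>.
\<close>

lemma sinh_normal_score_diff_le:
  assumes "\<bar>z - w\<bar> \<le> 1"
  shows "sqrt (1 + z\<^sup>2) * \<bar>sinh_normal_score z - sinh_normal_score w\<bar> \<le> 2 * \<bar>z - w\<bar>"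
proof -
  have same: "sqrt (1 + z\<^sup>2) * \<bar>sinh_normal_score z - sinh_normal_score w\<bar> \<le> 2 * \<bar>z - w\<bar>"
    if "0 \<le> z" "0 \<le> w" for z w :: real
  proof -
    have "\<bar>sinh_normal_score z - sinh_normal_score w\<bar> \<le>
        \<bar>arsinh z / sqrt (1 + z\<^sup>2) - arsinh w / sqrt (1 + w\<^sup>2)\<bar> + \<bar>z / (1 + z\<^sup>2) - w / (1 + w\<^sup>2)\<bar>"
      unfolding sinh_normal_score_def by linarith
    then have "sqrt (1 + z\<^sup>2) * \<bar>sinh_normal_score z - sinh_normal_score w\<bar> \<le>
        sqrt (1 + z\<^sup>2) * (\<bar>arsinh z / sqrt (1 + z\<^sup>2) - arsinh w / sqrt (1 + w\<^sup>2)\<bar> +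
          \<bar>z / (1 + z\<^sup>2) - w / (1 + w\<^sup>2)\<bar>)"
      by (intro mult_left_mono) auto
    also have "\<dots> \<le> \<bar>z - w\<bar> + \<bar>z - w\<bar>"
      unfolding distrib_left
      by (intro add_mono arsinh_score_diff_le_nonneg rational_score_diff_le that)
    finally show ?thesis by simp
  qed
  have opposite: "sqrt (1 + z\<^sup>2) * \<bar>sinh_normal_score z + sinh_normal_score w\<bar> \<le> 2 * (z + w)"
    if "0 \<le> z" "0 \<le> w" "z + w \<le> 1" for z w
  proof -
    have "0 \<le> sinh_normal_score z + sinh_normal_score w"
      using that arsinh_bounds unfolding sinh_normal_score_def
      by (intro add_nonneg_nonneg divide_nonneg_nonneg) auto
    then show ?thesis using score_sum_le[OF that] by simp
  qed
  consider "0 \<le> z" "0 \<le> w" | "z \<le> 0" "w \<le> 0" | "0 \<le> z" "w \<le> 0" | "z \<le> 0" "0 \<le> w"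
    by linarith
  then show ?thesis
  proof cases
    case 1
    then show ?thesis by (rule same)
  next
    case 2
    then show ?thesis using same[of "- z" "- w"] by (simp add: abs_minus_commute)
  next
    case 3
    then show ?thesis using opposite[of z "- w"] assms by simp
  next
    case 4
    then show ?thesis using opposite[of "- z" w] assms by (simp add: abs_minus_commute)
  qed
qed

lemma arsinh_scale_le:
  fixes w r :: real
  assumes "0 \<le> r" "0 \<le> w"
  shows "arsinh (exp r * w) \<le> arsinh w + r"
proof -
  have "exp r * w \<le> sinh (arsinh w + r)"
  proof -
    define a where "a = arsinh w"
    have a: "w = sinh a" "0 \<le> a" using arsinh_bounds[OF assms(2)] by (auto simp: a_def)
    have "exp r = sinh r + cosh r" by (simp add: sinh_plus_cosh)
    then have "sinh (a + r) - exp r * sinh a = sinh r * (cosh a - sinh a)"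
      by (simp add: sinh_add algebra_simps)
    moreover have "0 \<le> sinh r * (cosh a - sinh a)"
      using assms(1) sinh_le_cosh_real[of a] by (intro mult_nonneg_nonneg) auto
    ultimately show ?thesis by (simp add: a arsinh_sinh_real)
  qed
  then have "arsinh (exp r * w) \<le> arsinh (sinh (arsinh w + r))" by simp
  then show ?thesis by (simp only: arsinh_sinh_real)
qed

lemma abs_arsinh: "\<bar>arsinh z\<bar> = arsinh \<bar>z\<bar>" for z :: real
  using arsinh_bounds[of z] arsinh_bounds[of "-z"] by (cases "0 \<le> z") auto

lemma sinh_normal_potential_abs: "sinh_normal_potential \<bar>z\<bar> = sinh_normal_potential z"
  by (auto simp: abs_if)

lemma sinh_normal_potential_mono:
  assumes "\<bar>v\<bar> \<le> \<bar>w\<bar>"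
  shows "sinh_normal_potential v \<le> sinh_normal_potential w"
proof -
  have "(arsinh \<bar>v\<bar>)\<^sup>2 \<le> (arsinh \<bar>w\<bar>)\<^sup>2" using assms arsinh_bounds(1)[of "\<bar>v\<bar>"] by (intro power_mono) auto
  moreover have "v\<^sup>2 \<le> w\<^sup>2" using assms by (simp flip: abs_le_square_iff)
  ultimately show ?thesis
    unfolding sinh_normal_potential_def by (intro add_mono divide_right_mono) (auto simp flip: abs_arsinh)
qed

text \<open>
  Shrinking the argument lowers the potential, and only the term \<open>\<tau>\<close> remains.  Stretching it by
  \<open>exp r\<close> moves \<open>arsinh\<close> by at most \<open>r\<close> and raises the logarithmic part of the potential by at most \<open>r\<close>,
  which \<open>\<tau> = - r\<close> cancels.  The square root is a smooth substitute for \<open>\<bar>arsinh w\<bar>\<close>.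
\<close>

lemma sinh_normal_potential_scale_le:
  assumes \<tau>: "\<bar>\<tau>\<bar> \<le> t" and t: "t \<le> 1"
  shows "sinh_normal_potential (exp (- \<tau>) * w) + \<tau> \<le> sinh_normal_potential w + t * (sqrt (1 + (arsinh w)\<^sup>2) + 1 / 2)"
proof (cases "0 \<le> \<tau>")
  case True
  have "\<bar>exp (- \<tau>) * w\<bar> \<le> 1 * \<bar>w\<bar>"
    unfolding abs_mult using True by (intro mult_right_mono) auto
  then have "sinh_normal_potential (exp (- \<tau>) * w) \<le> sinh_normal_potential w"
    by (intro sinh_normal_potential_mono) simp
  moreover have "\<tau> \<le> t * (sqrt (1 + (arsinh w)\<^sup>2) + 1 / 2)"
  proof -
    have "t * 1 \<le> t * (sqrt (1 + (arsinh w)\<^sup>2) + 1 / 2)"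
      using \<tau> sqrt_one_plus_square_ge(1)[of "arsinh w"] by (intro mult_left_mono) linarith+
    then show ?thesis using \<tau> by simp
  qed
  ultimately show ?thesis by simp
next
  case False
  define r where "r = - \<tau>"
  have r: "0 \<le> r" "r \<le> t" using False \<tau> by (auto simp: r_def)
  define u where "u = arsinh \<bar>w\<bar>"
  have u: "0 \<le> u" by (simp add: u_def arsinh_bounds)
  have "(arsinh (exp r * \<bar>w\<bar>))\<^sup>2 \<le> (u + r)\<^sup>2"
    unfolding u_def using arsinh_scale_le[OF r(1), of "\<bar>w\<bar>"] by (intro power_mono arsinh_bounds) auto
  moreover have "ln (1 + (exp r * \<bar>w\<bar>)\<^sup>2) \<le> 2 * r + ln (1 + \<bar>w\<bar>\<^sup>2)"
  proof -
    have "1 + (exp r * \<bar>w\<bar>)\<^sup>2 \<le> exp (2 * r) * (1 + \<bar>w\<bar>\<^sup>2)"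
      unfolding exp_double using r by (simp add: power_mult_distrib distrib_left one_le_power)
    then have "ln (1 + (exp r * \<bar>w\<bar>)\<^sup>2) \<le> ln (exp (2 * r) * (1 + \<bar>w\<bar>\<^sup>2))"
      by (intro ln_mono) auto
    also have "\<dots> = 2 * r + ln (1 + \<bar>w\<bar>\<^sup>2)" by (subst ln_mult) auto
    finally show ?thesis .
  qed
  ultimately have "sinh_normal_potential (exp r * \<bar>w\<bar>) \<le> (u + r)\<^sup>2 / 2 + (2 * r + ln (1 + \<bar>w\<bar>\<^sup>2)) / 2"
    unfolding sinh_normal_potential_def by (intro add_mono divide_right_mono) auto
  also have "\<dots> = sinh_normal_potential \<bar>w\<bar> + r * u + r * r / 2 + r"
    by (simp add: sinh_normal_potential_def u_def power2_eq_square field_simps)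
  finally have "sinh_normal_potential (exp r * \<bar>w\<bar>) \<le>
      sinh_normal_potential w + (r * u + r * r / 2) + r"
    by (simp add: sinh_normal_potential_abs)
  moreover have "r * u + r * r / 2 \<le> t * (sqrt (1 + (arsinh w)\<^sup>2) + 1 / 2)"
  proof -
    have "u \<le> sqrt (1 + (arsinh w)\<^sup>2)"
      using sqrt_one_plus_square_ge(2)[of "arsinh w"] by (simp add: u_def abs_arsinh)
    then have "r * (u + r / 2) \<le> t * (sqrt (1 + (arsinh w)\<^sup>2) + 1 / 2)"
      using r t u by (intro mult_mono) auto
    then show ?thesis by (simp add: algebra_simps)
  qed
  moreover have "sinh_normal_potential (exp r * \<bar>w\<bar>) = sinh_normal_potential (exp (- \<tau>) * w)"
    using sinh_normal_potential_abs[of "exp r * w"] by (simp add: abs_mult r_def)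
  ultimately show ?thesis by (simp add: r_def)
qed

section \<open>The law of an affine image of the hyperbolic sine of a Gaussian\<close>

definition sinh_normal_density :: "real \<Rightarrow> real \<Rightarrow> real \<Rightarrow> real" where
  "sinh_normal_density a c z = exp (- sinh_normal_potential ((z - a) / c)) / (c * sqrt (2 * pi))"

lemma sinh_normal_density_pos: "0 < c \<Longrightarrow> 0 < sinh_normal_density a c z"
  by (simp add: sinh_normal_density_def)

lemma measurable_sinh_normal_potential [measurable]: "sinh_normal_potential \<in> borel_measurable borel"
  by (intro borel_measurable_continuous_onI continuous_at_imp_continuous_on ballI
      DERIV_isCont[OF DERIV_sinh_normal_potential[OF DERIV_ident]])

lemma measurable_sinh_normal_density [measurable]: "sinh_normal_density a c \<in> borel_measurable borel"
  unfolding sinh_normal_density_def[abs_def] by measurable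

lemma measurable_sinh [measurable]: "(sinh :: real \<Rightarrow> real) \<in> borel_measurable borel"
  by (intro borel_measurable_continuous_onI continuous_intros)

lemma sinh_normal_potential_sinh: "sinh_normal_potential (sinh u) = u\<^sup>2 / 2 + ln (cosh u)"
proof -
  have "ln (1 + (sinh u)\<^sup>2) = ln ((cosh u)\<^sup>2)" by (simp add: cosh_square_eq add_ac)
  also have "\<dots> = 2 * ln (cosh u)" by (simp add: ln_realpow)
  finally show ?thesis by (simp add: sinh_normal_potential_def arsinh_sinh_real)
qed

lemma exp_minus_sinh_normal_potential_sinh:
  "exp (- sinh_normal_potential (sinh u)) / sqrt (2 * pi) = std_normal_density u / cosh u"
proof -
  have "exp (- sinh_normal_potential (sinh u)) = exp (- u\<^sup>2 / 2 - ln (cosh u))"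
    by (simp add: sinh_normal_potential_sinh)
  also have "\<dots> = exp (- u\<^sup>2 / 2) / cosh u"
    by (simp only: exp_diff exp_ln[OF cosh_real_pos])
  finally show ?thesis by (simp add: std_normal_density_def)
qed

text \<open>
  Change of variables along the inverse \<open>z \<mapsto> arsinh ((z - a) / c)\<close>.
\<close>

lemma distr_sinh_normal:
  assumes c: "0 < c"
  shows "distr (density lborel std_normal_density) borel (\<lambda>u. a + c * sinh u) =
    density lborel (sinh_normal_density a c)"
proof (rule measure_eqI)
  fix A assume "A \<in> sets (distr (density lborel std_normal_density) borel (\<lambda>u. a + c * sinh u))"
  then have A [measurable]: "A \<in> sets borel" by simp
  let ?f = "\<lambda>u. ennreal (std_normal_density u) * indicator A (a + c * sinh u)"
  let ?g = "\<lambda>z. arsinh ((z - a) / c)"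
  let ?g' = "\<lambda>z. 1 / sqrt (((z - a) / c)\<^sup>2 + 1) / c"
  have "emeasure (distr (density lborel std_normal_density) borel (\<lambda>u. a + c * sinh u)) A =
      (\<integral>\<^sup>+z. indicator A z \<partial>distr (density lborel std_normal_density) borel (\<lambda>u. a + c * sinh u))"
    by simp
  also have "\<dots> = (\<integral>\<^sup>+u. ?f u \<partial>lborel)"
    by (subst nn_integral_distr) (auto simp: nn_integral_density)
  also have "\<dots> = (\<integral>\<^sup>+z. ?f (?g z) * ennreal (?g' z) \<partial>lborel)"
  proof (rule nn_integral_substitution_real_line)
    show "(?g has_real_derivative ?g' z) (at z)" for z
    proof -
      have "((\<lambda>z. (z - a) / c) has_real_derivative 1 / c) (at z)"
        using c by (auto intro!: derivative_eq_intros)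
      from DERIV_chain2[OF arsinh_real_has_field_derivative this] show ?thesis by simp
    qed
    have "((z - a) / c)\<^sup>2 + 1 \<noteq> 0" for z using one_plus_square_pos[of "(z - a) / c"] by linarith
    then show "continuous_on UNIV ?g'"
      using c by (intro continuous_intros) auto
    show "0 \<le> ?g' z" for z using c by simp
    show "filterlim ?g at_top at_top"
      using c by (intro filterlim_compose[OF arsinh_real_at_top]) real_asymp
    show "filterlim ?g at_bot at_bot"
      using c by (intro filterlim_compose[OF arsinh_real_at_bot]) real_asymp
  qed simp
  also have "\<dots> = (\<integral>\<^sup>+z. ennreal (sinh_normal_density a c z) * indicator A z \<partial>lborel)"
  proof (rule nn_integral_cong)
    fix z
    have "sinh_normal_density a c z = exp (- sinh_normal_potential (sinh (?g z))) / sqrt (2 * pi) / c"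
      by (simp add: sinh_normal_density_def mult.commute)
    also have "\<dots> = std_normal_density (?g z) * ?g' z"
      unfolding exp_minus_sinh_normal_potential_sinh cosh_arsinh_real by simp
    finally have "std_normal_density (?g z) * ?g' z = sinh_normal_density a c z" by simp
    moreover have "a + c * sinh (?g z) = z" using c by simp
    ultimately show "?f (?g z) * ennreal (?g' z) = ennreal (sinh_normal_density a c z) * indicator A z"
      using c by (simp add: mult_ac flip: ennreal_mult)
  qed
  also have "\<dots> = emeasure (density lborel (sinh_normal_density a c)) A"
    by (subst emeasure_density) auto
  finally show "emeasure (distr (density lborel std_normal_density) borel (\<lambda>u. a + c * sinh u)) A =
      emeasure (density lborel (sinh_normal_density a c)) A" .
qed simp

lemma prob_space_std_normal: "prob_space (density lborel std_normal_density)"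
  by (rule prob_space_normal_density) simp

lemma prob_space_sinh_normal:
  assumes "0 < c"
  shows "prob_space (density lborel (sinh_normal_density a c))"
  unfolding distr_sinh_normal[OF assms, symmetric]
  by (rule prob_space.prob_space_distr[OF prob_space_std_normal]) simp

text \<open>
  In the coordinate \<open>z = sinh u\<close> the integrand is the density of \<open>\<sigma> + sinh Y\<close>.
\<close>

lemma nn_integral_exp_minus_shift_loss:
  "(\<integral>\<^sup>+u. ennreal (std_normal_density u *
      exp (sinh_normal_potential (sinh u) - sinh_normal_potential (sinh u - \<sigma>))) \<partial>lborel) = 1"
proof -
  interpret prob_space "density lborel (sinh_normal_density \<sigma> 1)"
    by (rule prob_space_sinh_normal) simp
  have "1 = (\<integral>\<^sup>+z. ennreal (sinh_normal_density \<sigma> 1 z) \<partial>lborel)"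
    using emeasure_space_1 by (simp add: emeasure_density)
  also have "\<dots> = (\<integral>\<^sup>+u. ennreal (sinh_normal_density \<sigma> 1 (sinh u)) * ennreal (cosh u) \<partial>lborel)"
    by (rule nn_integral_substitution_real_line)
      (auto intro!: derivative_eq_intros continuous_intros sinh_real_at_top sinh_real_at_bot)
  also have "\<dots> = (\<integral>\<^sup>+u. ennreal (std_normal_density u *
      exp (sinh_normal_potential (sinh u) - sinh_normal_potential (sinh u - \<sigma>))) \<partial>lborel)"
  proof (rule nn_integral_cong)
    fix u
    have "std_normal_density u = exp (- sinh_normal_potential (sinh u)) / sqrt (2 * pi) * cosh u"
      unfolding exp_minus_sinh_normal_potential_sinh by simp
    then have "std_normal_density u * exp (sinh_normal_potential (sinh u) - sinh_normal_potential (sinh u - \<sigma>))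
        = sinh_normal_density \<sigma> 1 (sinh u) * cosh u"
      by (simp add: sinh_normal_density_def exp_diff exp_minus field_simps)
    then show "ennreal (sinh_normal_density \<sigma> 1 (sinh u)) * ennreal (cosh u) =
      ennreal (std_normal_density u * exp (sinh_normal_potential (sinh u) - sinh_normal_potential (sinh u - \<sigma>)))"
      using sinh_normal_density_pos[of 1 \<sigma> "sinh u"] by (simp add: ennreal_mult)
  qed
  finally show ?thesis by simp
qed

section \<open>Moments of the privacy loss\<close>

lemma lipschitz_C1_sqrt: "lipschitz_C1 (\<lambda>u. sqrt (1 + u\<^sup>2)) (\<lambda>u. u / sqrt (1 + u\<^sup>2)) 1"
proof
  show "continuous_on UNIV (\<lambda>u::real. u / sqrt (1 + u\<^sup>2))"
    by (intro continuous_intros) simp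
qed (rule DERIV_sqrt_one_plus_square abs_divide_sqrt_one_plus_square_le)+

text \<open>
  The logarithm of the ratio of the densities of \<open>sinh Y\<close> and \<open>\<sigma> + sinh Y\<close>, at the point \<open>sinh u\<close>.
\<close>

definition shift_loss :: "real \<Rightarrow> real \<Rightarrow> real" where
  "shift_loss \<sigma> u = sinh_normal_potential (sinh u - \<sigma>) - sinh_normal_potential (sinh u)"

lemma lipschitz_shift_loss:
  assumes "\<bar>\<sigma>\<bar> \<le> 1"
  shows "lipschitz_C1 (shift_loss \<sigma>)
    (\<lambda>u. cosh u * (sinh_normal_score (sinh u - \<sigma>) - sinh_normal_score (sinh u))) (2 * \<bar>\<sigma>\<bar>)"
proof
  show "(shift_loss \<sigma> has_real_derivative
      cosh u * (sinh_normal_score (sinh u - \<sigma>) - sinh_normal_score (sinh u))) (at u)" for u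
    unfolding shift_loss_def[abs_def]
    by (auto intro!: derivative_eq_intros simp: algebra_simps)
  show "continuous_on UNIV
      (\<lambda>u. cosh u * (sinh_normal_score (sinh u - \<sigma>) - sinh_normal_score (sinh u)))"
    by (intro continuous_intros continuous_on_compose2[OF continuous_sinh_normal_score[of UNIV]]) auto
  fix u
  have "cosh u = sqrt (1 + (sinh u)\<^sup>2)"
    by (rule real_sqrt_unique[symmetric]) (auto simp: cosh_square_eq)
  then show "\<bar>cosh u * (sinh_normal_score (sinh u - \<sigma>) - sinh_normal_score (sinh u))\<bar> \<le> 2 * \<bar>\<sigma>\<bar>"
    using sinh_normal_score_diff_le[of "sinh u" "sinh u - \<sigma>"] assms
    by (simp add: abs_mult abs_minus_commute)
qed

text \<open>
  Concentration for the negated loss, whose exponential has mean 1.  The Lipschitz constant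
  \<open>2 \<bar>\<sigma>\<bar>\<close> gives \<open>(2 \<bar>\<sigma>\<bar>)\<^sup>2 / 2 = 2 \<sigma>\<^sup>2\<close>.
\<close>

lemma mean_shift_loss_le:
  assumes "\<bar>\<sigma>\<bar> \<le> 1"
  shows "(\<integral>u. std_normal_density u * shift_loss \<sigma> u \<partial>lborel) \<le> 2 * \<sigma>\<^sup>2"
proof -
  note lip = lipschitz_C1_cmult[OF lipschitz_shift_loss[OF assms], of "- 1"]
  interpret lipschitz_C1 "\<lambda>u. - 1 * shift_loss \<sigma> u" "\<lambda>u. - 1 *
    (cosh u * (sinh_normal_score (sinh u - \<sigma>) - sinh_normal_score (sinh u)))" "\<bar>- 1\<bar> * (2 * \<bar>\<sigma>\<bar>)"
    by (rule lip)
  have "(\<integral>u. std_normal_density u * exp (- 1 * shift_loss \<sigma> u) \<partial>lborel) = 1"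
  proof -
    have "ennreal (\<integral>u. std_normal_density u * exp (1 * (- 1 * shift_loss \<sigma> u)) \<partial>lborel) =
        (\<integral>\<^sup>+u. ennreal (std_normal_density u * exp (1 * (- 1 * shift_loss \<sigma> u))) \<partial>lborel)"
      by (rule nn_integral_eq_integral[symmetric, OF integrable_exp]) simp
    also have "\<dots> = 1"
      using nn_integral_exp_minus_shift_loss[of \<sigma>] by (simp add: shift_loss_def)
    finally show ?thesis
      by (simp add: ennreal_eq_1)
  qed
  then have "1 \<le> exp ((\<integral>u. std_normal_density u * (- 1 * shift_loss \<sigma> u) \<partial>lborel) + (2 * \<bar>\<sigma>\<bar>)\<^sup>2 / 2)"
    using gaussian_mgf_lipschitz[OF lip] by simp
  then have "0 \<le> (\<integral>u. std_normal_density u * (- 1 * shift_loss \<sigma> u) \<partial>lborel) + (2 * \<bar>\<sigma>\<bar>)\<^sup>2 / 2"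
    by simp
  then show ?thesis by (simp add: power2_eq_square)
qed

lemma mean_sqrt_one_plus_square_le:
  "(\<integral>u. std_normal_density u * sqrt (1 + u\<^sup>2) \<partial>lborel) \<le> 3 / 2"
proof -
  interpret lipschitz_C1 "\<lambda>u. sqrt (1 + u\<^sup>2)" "\<lambda>u. u / sqrt (1 + u\<^sup>2)" 1
    by (rule lipschitz_C1_sqrt)
  have moment: "integrable lborel (\<lambda>u. std_normal_density u * u\<^sup>2)"
    by (rule integrable_std_normal_moment)
  have "(\<integral>u. std_normal_density u * sqrt (1 + u\<^sup>2) \<partial>lborel) \<le>
      (\<integral>u. std_normal_density u + (1 / 2) * (std_normal_density u * u\<^sup>2) \<partial>lborel)"
  proof (rule integral_mono)
    show "integrable lborel (\<lambda>u. std_normal_density u + (1 / 2) * (std_normal_density u * u\<^sup>2))"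
      using moment by (intro Bochner_Integration.integrable_add integrable_mult_right) auto
    fix u
    have "1 + q \<le> (1 + q / 2)\<^sup>2" for q :: real
      by (simp add: power2_eq_square algebra_simps)
    then have "sqrt (1 + u\<^sup>2) \<le> 1 + u\<^sup>2 / 2"
      by (intro real_le_lsqrt) auto
    then have "std_normal_density u * sqrt (1 + u\<^sup>2) \<le> std_normal_density u * (1 + u\<^sup>2 / 2)"
      by (intro mult_left_mono) auto
    then show "std_normal_density u * sqrt (1 + u\<^sup>2) \<le>
        std_normal_density u + (1 / 2) * (std_normal_density u * u\<^sup>2)"
      by (simp add: algebra_simps)
  qed (rule integrable_self)
  also have "\<dots> = 1 + (1 / 2) * (\<integral>u. std_normal_density u * u\<^sup>2 \<partial>lborel)"
    using moment by simp
  also have "(\<integral>u. std_normal_density u * u\<^sup>2 \<partial>lborel) = 1"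
    using integral_std_normal_moment_even[of 1] by (simp add: fact_numeral)
  finally show ?thesis by simp
qed

text \<open>
  Coefficientwise in \<open>\<beta>\<close> and in \<open>r = sqrt t \<le> 1\<close>: the constant term needs \<open>r\<^sup>2 s \<le> 4 r s\<close>, the
  coefficient of \<open>\<beta>\<close> needs \<open>2 r\<^sup>2 s \<le> 4 r s\<close> and \<open>r\<^sup>4 / 2 \<le> 2 r\<^sup>2\<close>.
\<close>

lemma cdp_budget:
  fixes s t \<beta> :: real
  assumes s: "0 \<le> s" and t: "0 \<le> t" "t \<le> 1" and \<beta>: "0 \<le> \<beta>"
  shows "2 * s\<^sup>2 + t * (3 / 2) + t * (s + 1 / 2) + \<beta> * (2 * s + t)\<^sup>2 / 2 \<le> 2 * (1 + \<beta>) * (sqrt t + s)\<^sup>2"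
proof -
  define r where "r = sqrt t"
  have r: "t = r\<^sup>2" "0 \<le> r" "r \<le> 1" using t by (auto simp: r_def)
  have rs: "r * (r * s) \<le> 1 * (r * s)" using r s by (intro mult_right_mono) auto
  have "r * r \<le> 1 * 1" using r by (intro mult_mono) auto
  then have rr: "r * r * (r * r) \<le> 1 * (r * r)" by (intro mult_right_mono) auto
  have nonneg: "0 \<le> r * r" "0 \<le> r * s" using r s by auto
  have budget: "2 * (r + s)\<^sup>2 = 2 * (r * r) + 4 * (r * s) + 2 * (s * s)"
    by (simp add: power2_eq_square algebra_simps)
  have "(2 * s + t)\<^sup>2 / 2 = 2 * (s * s) + 2 * (r * (r * s)) + r * r * (r * r) / 2"
    unfolding r(1) by (simp add: power2_eq_square algebra_simps)
  also have "\<dots> \<le> 2 * (r + s)\<^sup>2"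
    unfolding budget using rs rr nonneg by linarith
  finally have "\<beta> * ((2 * s + t)\<^sup>2 / 2) \<le> \<beta> * (2 * (r + s)\<^sup>2)"
    using \<beta> by (rule mult_left_mono)
  moreover have "2 * s\<^sup>2 + t * (3 / 2) + t * (s + 1 / 2) = 2 * (s * s) + 2 * (r * r) + r * (r * s)"
    unfolding r(1) by (simp add: power2_eq_square algebra_simps)
  then have "2 * s\<^sup>2 + t * (3 / 2) + t * (s + 1 / 2) \<le> 2 * (r + s)\<^sup>2"
    unfolding budget using rs nonneg by linarith
  ultimately show ?thesis by (simp add: r_def algebra_simps)
qed

text \<open>
  The shift is taken before the scaling, so that the loss of the shift is a function of the Gaussian
  coordinate \<open>u\<close> itself; the coordinate \<open>v = arsinh (sinh u - \<sigma>)\<close> in which the scaling acts is within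
  \<open>s\<close> of \<open>u\<close>.
\<close>

lemma sinh_normal_loss_moment_le:
  assumes \<sigma>: "\<bar>\<sigma>\<bar> \<le> s" and s: "s \<le> 1" and \<tau>: "\<bar>\<tau>\<bar> \<le> t" and t: "t \<le> 1" and \<beta>: "0 \<le> \<beta>"
  shows "(\<integral>\<^sup>+u. ennreal (std_normal_density u * exp (\<beta> *
      (sinh_normal_potential (exp (- \<tau>) * (sinh u - \<sigma>)) + \<tau> - sinh_normal_potential (sinh u)))) \<partial>lborel)
    \<le> ennreal (exp (\<beta> * (2 * (1 + \<beta>) * (sqrt t + s)\<^sup>2)))"
proof -
  define F where "F u = \<beta> * (shift_loss \<sigma> u + t * sqrt (1 + u\<^sup>2))" for u
  have \<sigma>1: "\<bar>\<sigma>\<bar> \<le> 1" and t0: "0 \<le> t" and s0: "0 \<le> s" using \<sigma> s \<tau> by linarith+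
  note lip_shift = lipschitz_shift_loss[OF \<sigma>1]
  obtain F' where lip: "lipschitz_C1 F F' (\<bar>\<beta>\<bar> * (2 * \<bar>\<sigma>\<bar> + \<bar>t\<bar> * 1))"
    using lipschitz_C1_cmult[OF lipschitz_C1_add[OF lip_shift lipschitz_C1_cmult[OF lipschitz_C1_sqrt, of t]], of \<beta>]
    unfolding F_def by blast
  interpret F: lipschitz_C1 F F' "\<bar>\<beta>\<bar> * (2 * \<bar>\<sigma>\<bar> + \<bar>t\<bar> * 1)" by (rule lip)
  have pointwise: "sinh_normal_potential (exp (- \<tau>) * (sinh u - \<sigma>)) + \<tau> - sinh_normal_potential (sinh u)
      \<le> shift_loss \<sigma> u + t * sqrt (1 + u\<^sup>2) + t * (s + 1 / 2)" for u
  proof -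
    define v where "v = arsinh (sinh u - \<sigma>)"
    have "\<bar>v - u\<bar> \<le> s"
      using abs_arsinh_diff_le[of "sinh u - \<sigma>" "sinh u"] \<sigma> by (simp add: v_def arsinh_sinh_real)
    then have "sqrt (1 + v\<^sup>2) \<le> sqrt (1 + u\<^sup>2) + s"
      using abs_sqrt_one_plus_square_diff_le[of v u] by linarith
    then have "t * (sqrt (1 + v\<^sup>2) + 1 / 2) \<le> t * (sqrt (1 + u\<^sup>2) + s + 1 / 2)"
      using t0 by (intro mult_left_mono) auto
    then show ?thesis
      using sinh_normal_potential_scale_le[OF \<tau> t, of "sinh u - \<sigma>"]
      by (simp add: shift_loss_def algebra_simps flip: v_def)
  qed
  have mgf: "(\<integral>u. std_normal_density u * exp (F u) \<partial>lborel) \<le>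
      exp (\<beta> * (2 * s\<^sup>2 + t * (3 / 2)) + (\<beta> * (2 * s + t))\<^sup>2 / 2)"
  proof -
    interpret S: lipschitz_C1 "shift_loss \<sigma>" "\<lambda>u. cosh u *
        (sinh_normal_score (sinh u - \<sigma>) - sinh_normal_score (sinh u))" "2 * \<bar>\<sigma>\<bar>"
      by (rule lip_shift)
    interpret R: lipschitz_C1 "\<lambda>u. sqrt (1 + u\<^sup>2)" "\<lambda>u. u / sqrt (1 + u\<^sup>2)" 1
      by (rule lipschitz_C1_sqrt)
    have "(\<integral>u. std_normal_density u * F u \<partial>lborel) =
        (\<integral>u. \<beta> * (std_normal_density u * shift_loss \<sigma> u) + \<beta> * t * (std_normal_density u * sqrt (1 + u\<^sup>2)) \<partial>lborel)"
      by (simp add: F_def algebra_simps)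
    also have "\<dots> = \<beta> * (\<integral>u. std_normal_density u * shift_loss \<sigma> u \<partial>lborel) +
        \<beta> * t * (\<integral>u. std_normal_density u * sqrt (1 + u\<^sup>2) \<partial>lborel)"
      using S.integrable_self R.integrable_self by simp
    also have "\<dots> \<le> \<beta> * (2 * s\<^sup>2) + \<beta> * t * (3 / 2)"
    proof (intro add_mono mult_left_mono mean_sqrt_one_plus_square_le)
      have "\<sigma>\<^sup>2 \<le> s\<^sup>2" using power_mono[OF \<sigma>, of 2] by simp
      then show "(\<integral>u. std_normal_density u * shift_loss \<sigma> u \<partial>lborel) \<le> 2 * s\<^sup>2"
        using mean_shift_loss_le[OF \<sigma>1] by linarith
    qed (use \<beta> t0 in auto)
    finally have mean: "(\<integral>u. std_normal_density u * F u \<partial>lborel) \<le> \<beta> * (2 * s\<^sup>2 + t * (3 / 2))"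
      by (simp only: distrib_left mult.assoc)
    have "(\<bar>\<beta>\<bar> * (2 * \<bar>\<sigma>\<bar> + \<bar>t\<bar> * 1))\<^sup>2 \<le> (\<beta> * (2 * s + t))\<^sup>2"
      using \<sigma> \<beta> t0 by (intro power_mono mult_mono) auto
    with mean show ?thesis
      by (intro order_trans[OF gaussian_mgf_lipschitz[OF lip]]) simp
  qed
  have square: "(\<beta> * x)\<^sup>2 / 2 = \<beta> * (\<beta> * x\<^sup>2 / 2)" for x
    by (simp add: power2_eq_square)
  have "exp (\<beta> * (t * (s + 1 / 2))) * (\<integral>u. std_normal_density u * exp (F u) \<partial>lborel) \<le>
      exp (\<beta> * (t * (s + 1 / 2))) * exp (\<beta> * (2 * s\<^sup>2 + t * (3 / 2)) + (\<beta> * (2 * s + t))\<^sup>2 / 2)"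
    by (intro mult_left_mono mgf) simp
  also have "\<dots> = exp (\<beta> * (t * (s + 1 / 2)) + (\<beta> * (2 * s\<^sup>2 + t * (3 / 2)) + (\<beta> * (2 * s + t))\<^sup>2 / 2))"
    by (rule exp_add[symmetric])
  also have "\<beta> * (t * (s + 1 / 2)) + (\<beta> * (2 * s\<^sup>2 + t * (3 / 2)) + (\<beta> * (2 * s + t))\<^sup>2 / 2) =
      \<beta> * (2 * s\<^sup>2 + t * (3 / 2) + t * (s + 1 / 2) + \<beta> * (2 * s + t)\<^sup>2 / 2)"
    unfolding square by (simp only: distrib_left add_ac)
  also have "exp \<dots> \<le> exp (\<beta> * (2 * (1 + \<beta>) * (sqrt t + s)\<^sup>2))"
    using mult_left_mono[OF cdp_budget[OF s0 t0 t \<beta>] \<beta>] by simp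
  finally have total: "exp (\<beta> * (t * (s + 1 / 2))) * (\<integral>u. std_normal_density u * exp (F u) \<partial>lborel)
      \<le> exp (\<beta> * (2 * (1 + \<beta>) * (sqrt t + s)\<^sup>2))" .
  have "(\<integral>\<^sup>+u. ennreal (std_normal_density u * exp (\<beta> *
      (sinh_normal_potential (exp (- \<tau>) * (sinh u - \<sigma>)) + \<tau> - sinh_normal_potential (sinh u)))) \<partial>lborel)
    \<le> (\<integral>\<^sup>+u. ennreal (exp (\<beta> * (t * (s + 1 / 2))) * (std_normal_density u * exp (1 * F u))) \<partial>lborel)"
  proof (intro nn_integral_mono ennreal_leI)
    fix u
    have "\<beta> * (sinh_normal_potential (exp (- \<tau>) * (sinh u - \<sigma>)) + \<tau> - sinh_normal_potential (sinh u))
        \<le> \<beta> * (t * (s + 1 / 2)) + F u"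
      using mult_left_mono[OF pointwise[of u] \<beta>] by (simp add: F_def algebra_simps)
    then have "std_normal_density u * exp (\<beta> *
        (sinh_normal_potential (exp (- \<tau>) * (sinh u - \<sigma>)) + \<tau> - sinh_normal_potential (sinh u)))
        \<le> std_normal_density u * exp (\<beta> * (t * (s + 1 / 2)) + F u)"
      by (intro mult_left_mono) auto
    then show "std_normal_density u * exp (\<beta> *
        (sinh_normal_potential (exp (- \<tau>) * (sinh u - \<sigma>)) + \<tau> - sinh_normal_potential (sinh u)))
        \<le> exp (\<beta> * (t * (s + 1 / 2))) * (std_normal_density u * exp (1 * F u))"
      by (simp add: exp_add mult_ac)
  qed
  also have "\<dots> = ennreal (\<integral>u. exp (\<beta> * (t * (s + 1 / 2))) * (std_normal_density u * exp (1 * F u)) \<partial>lborel)"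
    by (rule nn_integral_eq_integral) (use F.integrable_exp[of 1] in auto)
  also have "\<dots> \<le> ennreal (exp (\<beta> * (2 * (1 + \<beta>) * (sqrt t + s)\<^sup>2)))"
    using total by (intro ennreal_leI) simp
  finally show ?thesis .
qed

section \<open>Renyi divergences\<close>

text \<open>
  The Radon-Nikodym derivative is \<open>p / q\<close> almost everywhere.  If the moment is 0, its logarithm has
  the default value 0, which is covered by \<open>0 \<le> B\<close>.
\<close>

lemma renyi_divergence_le_density:
  fixes p q :: "real \<Rightarrow> real"
  assumes [measurable]: "p \<in> borel_measurable borel" "q \<in> borel_measurable borel"
    and p: "\<And>z. 0 \<le> p z" and q: "\<And>z. 0 < q z"
    and Q: "prob_space (density lborel q)" and \<alpha>: "1 < \<alpha>" and B: "0 \<le> B"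
    and moment: "(\<integral>\<^sup>+z. ennreal ((p z / q z) powr (\<alpha> - 1)) \<partial>density lborel p) \<le>
      ennreal (exp ((\<alpha> - 1) * B))"
  shows "renyi_divergence \<alpha> (density lborel p) (density lborel q) \<le> ereal B"
proof -
  interpret Q: prob_space "density lborel q" by fact
  have "density (density lborel q) (\<lambda>z. ennreal (p z / q z)) = density lborel (\<lambda>z. ennreal (q z) * ennreal (p z / q z))"
    by (rule density_density_eq) auto
  also have "(\<lambda>z. ennreal (q z) * ennreal (p z / q z)) = (\<lambda>z. ennreal (p z))"
  proof (rule ext)
    fix z
    have "ennreal (q z) * ennreal (p z / q z) = ennreal (q z * (p z / q z))"
      using p[of z] q[of z] by (intro ennreal_mult[symmetric]) auto
    then show "ennreal (q z) * ennreal (p z / q z) = ennreal (p z)"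
      using q[of z] by simp
  qed
  finally have P: "density (density lborel q) (\<lambda>z. ennreal (p z / q z)) = density lborel p" .
  have ac: "absolutely_continuous (density lborel q) (density lborel p)"
    unfolding P[symmetric] by (rule absolutely_continuousI_density) simp
  have "AE z in density lborel q. ennreal (p z / q z) = RN_deriv (density lborel q) (density lborel p) z"
    by (rule Q.RN_deriv_unique[OF _ P]) simp
  then have RN: "AE z in density lborel p. ennreal (p z / q z) = RN_deriv (density lborel q) (density lborel p) z"
    by (rule absolutely_continuous_AE[OF _ ac, rotated]) simp
  have "(\<integral>\<^sup>+z. ennreal (enn2real (RN_deriv (density lborel q) (density lborel p) z) powr (\<alpha> - 1)) \<partial>density lborel p)
      = (\<integral>\<^sup>+z. ennreal ((p z / q z) powr (\<alpha> - 1)) \<partial>density lborel p)"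
    (is "?E = _")
  proof (rule nn_integral_cong_AE)
    show "AE z in density lborel p. ennreal (enn2real (RN_deriv (density lborel q) (density lborel p) z) powr (\<alpha> - 1)) =
        ennreal ((p z / q z) powr (\<alpha> - 1))"
      using RN
    proof eventually_elim
      case (elim z)
      have "0 \<le> p z / q z" using p[of z] q[of z] by (intro divide_nonneg_pos)
      then show ?case unfolding elim[symmetric] by simp
    qed
  qed
  with moment have E: "?E \<le> ennreal (exp ((\<alpha> - 1) * B))" by simp
  then have fin: "?E \<noteq> \<infinity>" by (auto simp: top_unique)
  have "ln (enn2real ?E) \<le> (\<alpha> - 1) * B"
  proof (cases "0 < enn2real ?E")
    case True
    have "enn2real ?E \<le> exp ((\<alpha> - 1) * B)"
      using enn2real_mono[OF E] by simp
    then have "ln (enn2real ?E) \<le> ln (exp ((\<alpha> - 1) * B))"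
      using True by (intro ln_mono) auto
    then show ?thesis by simp
  next
    case False
    then have "enn2real ?E = 0" using enn2real_nonneg[of ?E] by linarith
    then show ?thesis using \<alpha> B by simp
  qed
  then have "1 / (\<alpha> - 1) * ln (enn2real ?E) \<le> B"
    using \<alpha> by (simp add: field_simps)
  then show ?thesis
    using ac fin by (simp add: renyi_divergence_def Let_def)
qed

text \<open>
  This covers the degenerate case of vanishing smooth sensitivity, where the mechanism has no density.
\<close>

lemma renyi_divergence_self:
  assumes "prob_space P"
  shows "renyi_divergence \<alpha> P P = 0"
proof -
  interpret prob_space P by fact
  have RN: "AE x in P. 1 = RN_deriv P P x"
    by (rule RN_deriv_unique) (auto simp: density_1)
  have "(\<integral>\<^sup>+x. ennreal (enn2real (RN_deriv P P x) powr (\<alpha> - 1)) \<partial>P) = (\<integral>\<^sup>+x. 1 \<partial>P)"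
  proof (rule nn_integral_cong_AE)
    show "AE x in P. ennreal (enn2real (RN_deriv P P x) powr (\<alpha> - 1)) = 1"
      using RN
    proof eventually_elim
      case (elim x)
      show ?case unfolding elim[symmetric] by simp
    qed
  qed
  then show ?thesis
    using emeasure_space_1 by (simp add: renyi_divergence_def absolutely_continuous_def zero_ereal_def)
qed

text \<open>
  The affine map that takes \<open>a + c sinh u\<close> to \<open>sinh u\<close> reduces the claim to \<open>\<sigma> = (a' - a) / c\<close> and
  \<open>\<tau> = ln (c' / c)\<close>.
\<close>

lemma renyi_divergence_sinh_normal_le:
  assumes c: "0 < c" "0 < c'" and shift: "\<bar>a' - a\<bar> \<le> s * c" and scale: "\<bar>ln (c' / c)\<bar> \<le> t"
    and s: "s \<le> 1" and t: "t \<le> 1" and \<alpha>: "1 < \<alpha>"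
  shows "renyi_divergence \<alpha> (density lborel (sinh_normal_density a c))
      (density lborel (sinh_normal_density a' c')) \<le> ereal (2 * (sqrt t + s)\<^sup>2 * \<alpha>)"
proof (rule renyi_divergence_le_density)
  define \<tau> \<sigma> where "\<tau> = ln (c' / c)" and "\<sigma> = (a' - a) / c"
  have \<sigma>: "\<bar>\<sigma>\<bar> \<le> s" using shift c by (simp add: \<sigma>_def field_simps)
  have \<tau>: "\<bar>\<tau>\<bar> \<le> t" using scale by (simp add: \<tau>_def)
  have exp_\<tau>: "exp \<tau> = c' / c" "exp (- \<tau>) = c / c'" using c by (simp_all add: \<tau>_def exp_minus)
  have ratio: "sinh_normal_density a c (a + c * sinh u) / sinh_normal_density a' c' (a + c * sinh u) =
      exp (sinh_normal_potential (exp (- \<tau>) * (sinh u - \<sigma>)) + \<tau> - sinh_normal_potential (sinh u))" for u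
  proof -
    have "(a + c * sinh u - a') / c' = exp (- \<tau>) * (sinh u - \<sigma>)"
      using c by (simp add: exp_\<tau> \<sigma>_def field_simps)
    then have "sinh_normal_density a c (a + c * sinh u) / sinh_normal_density a' c' (a + c * sinh u) =
        exp (- sinh_normal_potential (sinh u)) * (c' / c) / exp (- sinh_normal_potential (exp (- \<tau>) * (sinh u - \<sigma>)))"
      using c by (simp add: sinh_normal_density_def divide_simps)
    also have "\<dots> = exp (- sinh_normal_potential (sinh u) + \<tau> - - sinh_normal_potential (exp (- \<tau>) * (sinh u - \<sigma>)))"
      unfolding exp_diff exp_add exp_\<tau>(1) ..
    finally show ?thesis by (simp add: algebra_simps)
  qed
  have "(\<integral>\<^sup>+z. ennreal ((sinh_normal_density a c z / sinh_normal_density a' c' z) powr (\<alpha> - 1))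
        \<partial>density lborel (sinh_normal_density a c)) =
      (\<integral>\<^sup>+u. ennreal ((sinh_normal_density a c (a + c * sinh u) / sinh_normal_density a' c' (a + c * sinh u)) powr (\<alpha> - 1))
        \<partial>density lborel std_normal_density)"
    unfolding distr_sinh_normal[OF c(1), symmetric] by (rule nn_integral_distr) auto
  also have "\<dots> = (\<integral>\<^sup>+u. ennreal (std_normal_density u * exp ((\<alpha> - 1) *
      (sinh_normal_potential (exp (- \<tau>) * (sinh u - \<sigma>)) + \<tau> - sinh_normal_potential (sinh u)))) \<partial>lborel)"
    unfolding ratio by (subst nn_integral_density) (auto simp: exp_powr_real mult.commute simp flip: ennreal_mult)
  also have "\<dots> \<le> ennreal (exp ((\<alpha> - 1) * (2 * (1 + (\<alpha> - 1)) * (sqrt t + s)\<^sup>2)))"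
    by (rule sinh_normal_loss_moment_le[OF \<sigma> s \<tau> t]) (use \<alpha> in simp)
  finally show "(\<integral>\<^sup>+z. ennreal ((sinh_normal_density a c z / sinh_normal_density a' c' z) powr (\<alpha> - 1))
        \<partial>density lborel (sinh_normal_density a c)) \<le> ennreal (exp ((\<alpha> - 1) * (2 * (sqrt t + s)\<^sup>2 * \<alpha>)))"
    by (simp add: mult_ac)
  show "prob_space (density lborel (sinh_normal_density a' c'))"
    by (rule prob_space_sinh_normal) fact
qed (use c \<alpha> in \<open>auto intro!: less_imp_le sinh_normal_density_pos\<close>)

section \<open>Smooth sensitivity of neighbouring datasets\<close>

lemma hamming_dist_commute: "length x = length y \<Longrightarrow> hamming_dist x y = hamming_dist y x"
  unfolding hamming_dist_def by (rule arg_cong[where f = card]) auto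

lemma hamming_dist_triangle:
  assumes "length x = length y"
  shows "hamming_dist x z \<le> hamming_dist x y + hamming_dist y z"
proof -
  have "hamming_dist x z \<le> card ({i. i < length x \<and> x ! i \<noteq> y ! i} \<union> {i. i < length y \<and> y ! i \<noteq> z ! i})"
    unfolding hamming_dist_def using assms by (intro card_mono) auto
  also have "\<dots> \<le> hamming_dist x y + hamming_dist y z"
    unfolding hamming_dist_def by (rule card_Un_le)
  finally show ?thesis .
qed

text \<open>
  Moving the base point by one entry changes every exponent \<open>- t d\<close> by at most \<open>t\<close>.
\<close>

lemma smooth_sensitivity_le_neighbor:
  assumes xy: "x \<in> nlists n X" "y \<in> nlists n X" "neighboring x y" and t: "0 \<le> t"
  shows "smooth_sensitivity X n f t x \<le> ennreal (exp t) * smooth_sensitivity X n f t y"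
  unfolding smooth_sensitivity_def
proof (rule SUP_least)
  fix z assume z: "z \<in> nlists n X"
  have "hamming_dist y z \<le> hamming_dist x y + hamming_dist x z"
    using hamming_dist_triangle[of y x z] hamming_dist_commute[of x y] xy by simp
  then have "real (hamming_dist y z) \<le> 1 + real (hamming_dist x z)"
    using xy(3) unfolding neighboring_def by linarith
  then have "- t * real (hamming_dist x z) \<le> t + - t * real (hamming_dist y z)"
    using mult_left_mono[OF _ t] by (fastforce simp: algebra_simps)
  then have "ennreal (exp (- t * real (hamming_dist x z))) \<le>
      ennreal (exp t) * ennreal (exp (- t * real (hamming_dist y z)))"
    by (simp add: ennreal_leI flip: ennreal_mult exp_add)
  then have "ennreal (exp (- t * real (hamming_dist x z))) * local_sensitivity X n f z \<le>
      ennreal (exp t) * (ennreal (exp (- t * real (hamming_dist y z))) * local_sensitivity X n f z)"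
    unfolding mult.assoc[symmetric] by (rule mult_right_mono) simp
  also have "\<dots> \<le> ennreal (exp t) *
      (SUP z\<in>nlists n X. ennreal (exp (- t * real (hamming_dist y z))) * local_sensitivity X n f z)"
    using z by (intro mult_left_mono SUP_upper) auto
  finally show "ennreal (exp (- t * real (hamming_dist x z))) * local_sensitivity X n f z \<le>
      ennreal (exp t) * (SUP z\<in>nlists n X. ennreal (exp (- t * real (hamming_dist y z))) * local_sensitivity X n f z)" .
qed

lemma abs_diff_le_smooth_sensitivity:
  assumes "x \<in> nlists n X" "y \<in> nlists n X" "neighboring x y"
  shows "ennreal \<bar>f y - f x\<bar> \<le> smooth_sensitivity X n f t x"
proof -
  have "ennreal \<bar>f y - f x\<bar> \<le> local_sensitivity X n f x"
    unfolding local_sensitivity_def using assms by (intro SUP_upper) auto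
  also have "\<dots> = ennreal (exp (- t * real (hamming_dist x x))) * local_sensitivity X n f x"
    by (simp add: hamming_dist_def)
  also have "\<dots> \<le> smooth_sensitivity X n f t x"
    unfolding smooth_sensitivity_def using assms by (intro SUP_upper)
  finally show ?thesis .
qed

section \<open>Concentrated differential privacy of the mechanism\<close>

theorem proposition5:
  fixes X :: "'a set" and n :: nat and f :: "'a list \<Rightarrow> real"
    and s t \<epsilon> :: real
    and \<Omega> :: "'w measure" and Y Z :: "'w \<Rightarrow> real"
    and M :: "'a list \<Rightarrow> 'w \<Rightarrow> real"
  assumes "n \<ge> 1"
    and "s \<in> {0<..<1}" and "t \<in> {0<..<1}"
    and "\<And>x. x \<in> nlists n X \<Longrightarrow> smooth_sensitivity X n f t x < \<infinity>"
    and "prob_space \<Omega>" and "distributed \<Omega> lborel Y std_normal_density"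
    and "\<And>\<omega>. Z \<omega> = sinh (Y \<omega>)"
    and "\<And>x \<omega>. M x \<omega> = f x + 1 / s * enn2real (smooth_sensitivity X n f t x) * Z \<omega>"
    and "\<epsilon> = 2 * (sqrt t + s)"
  shows "CDP X n borel (1 / 2 * \<epsilon>\<^sup>2) (\<lambda>x. distr \<Omega> borel (M x))"
proof -
  interpret prob_space \<Omega> by fact
  define S where "S x = enn2real (smooth_sensitivity X n f t x)" for x
  define c where "c x = S x / s" for x
  have s: "0 < s" "s \<le> 1" and t: "0 < t" "t \<le> 1" using assms(2,3) by auto
  have Y [measurable]: "Y \<in> borel_measurable \<Omega>"
    using distributed_measurable[OF assms(6)] by simp
  have M_eq: "M x = (\<lambda>\<omega>. f x + c x * sinh (Y \<omega>))" for x
    by (rule ext) (simp add: assms(7,8) c_def S_def)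
  have M_meas [measurable]: "M x \<in> borel_measurable \<Omega>" for x
    unfolding M_eq by measurable
  have distr_M: "distr \<Omega> borel (M x) = density lborel (sinh_normal_density (f x) (c x))" if "0 < c x" for x
  proof -
    have "distr \<Omega> borel (M x) = distr (distr \<Omega> lborel Y) borel (\<lambda>u. f x + c x * sinh u)"
      unfolding M_eq by (subst distr_distr) (auto simp: comp_def)
    also have "distr \<Omega> lborel Y = density lborel std_normal_density"
      using assms(6) by (rule distributed_distr_eq_density)
    finally show ?thesis using distr_sinh_normal[OF that] by simp
  qed
  have S: "smooth_sensitivity X n f t x = ennreal (S x)" if "x \<in> nlists n X" for x
    using assms(4)[OF that] by (simp add: S_def less_top)
  have S_nonneg: "0 \<le> S x" for x by (simp add: S_def)
  have renyi: "renyi_divergence \<alpha> (distr \<Omega> borel (M x)) (distr \<Omega> borel (M y)) \<le> ereal (1 / 2 * \<epsilon>\<^sup>2 * \<alpha>)"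
    if xy: "x \<in> nlists n X" "y \<in> nlists n X" "neighboring x y" and \<alpha>: "1 < \<alpha>" for x y \<alpha>
  proof -
    have yx: "neighboring y x"
      using xy hamming_dist_commute[of x y] by (simp add: neighboring_def)
    have ratio: "S u \<le> exp t * S v" if "u \<in> nlists n X" "v \<in> nlists n X" "neighboring u v" for u v
      using smooth_sensitivity_le_neighbor[OF that, of t f] t S_nonneg that
      by (simp add: S flip: ennreal_mult)
    have diff: "\<bar>f y - f x\<bar> \<le> S x"
      using abs_diff_le_smooth_sensitivity[OF xy, of f t] S_nonneg xy by (simp add: S)
    show ?thesis
    proof (cases "S x = 0")
      case True
      then have "S y = 0" using ratio[OF xy(2,1) yx] S_nonneg[of y] by simp
      with True diff have "M y = M x" by (simp add: M_eq c_def)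
      moreover have "renyi_divergence \<alpha> (distr \<Omega> borel (M x)) (distr \<Omega> borel (M x)) = 0"
        by (intro renyi_divergence_self prob_space_distr) simp
      ultimately show ?thesis using \<alpha> by simp
    next
      case False
      then have Sx: "0 < S x" using S_nonneg[of x] by simp
      then have Sy: "0 < S y" using ratio[OF xy] S_nonneg[of y] by (cases "S y = 0") auto
      have c: "0 < c x" "0 < c y" using Sx Sy s by (auto simp: c_def)
      have "ln (S x) \<le> ln (exp t * S y)" "ln (S y) \<le> ln (exp t * S x)"
        using ratio[OF xy] ratio[OF xy(2,1) yx] Sx Sy by (auto intro!: ln_mono)
      then have "ln (S x) \<le> t + ln (S y)" "ln (S y) \<le> t + ln (S x)"
        using Sx Sy by (simp_all add: ln_mult)
      moreover have "ln (c y / c x) = ln (S y) - ln (S x)"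
        using Sx Sy s by (simp add: c_def ln_div)
      ultimately have "\<bar>ln (c y / c x)\<bar> \<le> t" by linarith
      moreover have "\<bar>f y - f x\<bar> \<le> s * c x" using diff s by (simp add: c_def)
      ultimately have "renyi_divergence \<alpha> (distr \<Omega> borel (M x)) (distr \<Omega> borel (M y)) \<le>
          ereal (2 * (sqrt t + s)\<^sup>2 * \<alpha>)"
        unfolding distr_M[OF c(1)] distr_M[OF c(2)]
        using renyi_divergence_sinh_normal_le[OF c] s t \<alpha> by blast
      moreover have "1 / 2 * \<epsilon>\<^sup>2 = 2 * (sqrt t + s)\<^sup>2"
        unfolding assms(9) by (simp only: power_mult_distrib) simp
      ultimately show ?thesis by simp
    qed
  qed
  have "distr \<Omega> borel (M x) \<in> space (prob_algebra borel)" for x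
    by (simp add: space_prob_algebra prob_space_distr)
  then show ?thesis using renyi by (auto simp: CDP_def)
qed

end
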